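(* (i) Let $n\ge1$, let $(T,m)$ be a probability space and let $\varphi=[\varphi_{ij}]:T\to M_n$ be an essentially bounded measurable function such that $\{\sqrt n\,\varphi_{ij}\mid 1\le i,j\le n\}$ is orthonormal in $L_2(T,m)$. Then for all $a\in M_n$, $$\operatorname{tr}|a|\le n\,\|\operatorname{tr}(a\varphi)\|_{L_\infty(T,m)} .$$ (ii) This order of growth is asymptotically optimal: there are constants $C,\beta,\delta>0$ such that for every $n\ge1$ there are a probability space $(T,m)$, a measurable function $\varphi=[\varphi_{ij}]:T\to M_n$ with $\|\varphi(t)\|_{M_n}\le C$ for almost every $t\in T$ and such that $\{\sqrt n\,\varphi_{ij}\mid 1\le i,j\le n\}$ is $\beta$-subgaussian and orthonormal in $L_2(T,m)$, and a non-zero matrix $a\in M_n$ such that $$\operatorname{tr}|a|\ge\delta\, n\,\|\operatorname{tr}(a\varphi)\|_{L_\infty(T,m)} .$$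
   Context: $M_n$ is the space of $n\times n$ complex matrices with the operator norm $\|\cdot\|_{M_n}$ on $n$-dimensional Hilbert space, and $|a|=(a^*a)^{1/2}$. A finite family $(\psi_k)$ of functions on a probability space $(T,m)$ is $\beta$-subgaussian if $\int e^{|\sum x_k\psi_k|^2/\beta^2}\,dm\le e$ for all complex scalars $(x_k)$ with $\sum|x_k|^2\le1$. Here $\operatorname{tr}(a\varphi)$ denotes the function $t\mapsto\operatorname{tr}(a\varphi(t))$. *)

theory Defs
  imports "HOL-Probability.Probability" "Jordan_Normal_Form.Schur_Decomposition"
begin

text \<open>The space of \<open>n \<times> n\<close> complex matrices is \<open>carrier_mat n n\<close>, with indices running
  over \<open>{..<n}\<close>. The library product \<open>v \<bullet>c w\<close> is linear in \<open>v\<close>.\<close>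

definition mat_trace :: "complex mat \<Rightarrow> complex" where
  "mat_trace A = (\<Sum>i<dim_row A. A $$ (i, i))"

definition hilbert_norm :: "complex vec \<Rightarrow> real" where
  "hilbert_norm v = sqrt (Re (v \<bullet>c v))"

definition mat_op_norm :: "complex mat \<Rightarrow> real" where
  "mat_op_norm A =
     (SUP v \<in> {v \<in> carrier_vec (dim_col A). hilbert_norm v \<le> 1}. hilbert_norm (A *\<^sub>v v))"

text \<open>In \<open>0 \<le> z\<close> for complex \<open>z\<close> the order is that of \<open>HOL-Library.Complex_Order\<close>, so
  the condition includes that \<open>z\<close> is real.\<close>

definition mat_psd :: "nat \<Rightarrow> complex mat \<Rightarrow> bool" where
  "mat_psd n P \<longleftrightarrow> P \<in> carrier_mat n n \<and> mat_adjoint P = P \<and>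
     (\<forall>v \<in> carrier_vec n. 0 \<le> (P *\<^sub>v v) \<bullet>c v)"

definition mat_sqrt :: "complex mat \<Rightarrow> complex mat" where
  "mat_sqrt A = (THE P. mat_psd (dim_row A) P \<and> P * P = A)"

definition mat_abs :: "complex mat \<Rightarrow> complex mat" where
  "mat_abs A = mat_sqrt (mat_adjoint A * A)"

text \<open>Measurability with respect to the Borel sets of \<open>M\<^sub>n\<close>, identified with
  the \<open>n\<^sup>2\<close>-dimensional complex space of matrix entries.\<close>

definition mat_measurable :: "nat \<Rightarrow> 'a measure \<Rightarrow> ('a \<Rightarrow> complex mat) \<Rightarrow> bool" where
  "mat_measurable n M \<phi> \<longleftrightarrow> (\<forall>t \<in> space M. \<phi> t \<in> carrier_mat n n) \<and>
     (\<forall>i<n. \<forall>j<n. (\<lambda>t. \<phi> t $$ (i, j)) \<in> borel_measurable M)"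

definition mat_ess_bounded :: "'a measure \<Rightarrow> ('a \<Rightarrow> complex mat) \<Rightarrow> bool" where
  "mat_ess_bounded M \<phi> \<longleftrightarrow> (\<exists>K. AE t in M. mat_op_norm (\<phi> t) \<le> K)"

definition Linf_norm :: "'a measure \<Rightarrow> ('a \<Rightarrow> complex) \<Rightarrow> ereal" where
  "Linf_norm M f = esssup M (\<lambda>t. ereal (cmod (f t)))"

definition orthonormal_L2 :: "'a measure \<Rightarrow> 'i set \<Rightarrow> ('i \<Rightarrow> 'a \<Rightarrow> complex) \<Rightarrow> bool" where
  "orthonormal_L2 M I \<psi> \<longleftrightarrow>
     (\<forall>k\<in>I. \<psi> k \<in> borel_measurable M \<and> integrable M (\<lambda>t. (cmod (\<psi> k t))\<^sup>2)) \<and>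
     (\<forall>k\<in>I. \<forall>l\<in>I. (LINT t|M. \<psi> k t * cnj (\<psi> l t)) = (if k = l then 1 else 0))"

text \<open>The integral is taken in the extended nonnegative reals, so the bound includes
  integrability of the exponential.\<close>

definition subgaussian :: "'a measure \<Rightarrow> real \<Rightarrow> 'i set \<Rightarrow> ('i \<Rightarrow> 'a \<Rightarrow> complex) \<Rightarrow> bool" where
  "subgaussian M \<beta> I \<psi> \<longleftrightarrow> finite I \<and> (\<forall>k\<in>I. \<psi> k \<in> borel_measurable M) \<and>
     (\<forall>x :: 'i \<Rightarrow> complex. (\<Sum>k\<in>I. (cmod (x k))\<^sup>2) \<le> 1 \<longrightarrow>
        (\<integral>\<^sup>+ t. ennreal (exp ((cmod (\<Sum>k\<in>I. x k * \<psi> k t))\<^sup>2 / \<beta>\<^sup>2)) \<partial>M) \<le> ennreal (exp 1))"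

text \<open>The family \<open>(\<surd>n \<phi>\<^sub>i\<^sub>j)\<close>, indexed by pairs \<open>(i, j)\<close>.\<close>

definition scaled_entries :: "nat \<Rightarrow> ('a \<Rightarrow> complex mat) \<Rightarrow> nat \<times> nat \<Rightarrow> 'a \<Rightarrow> complex" where
  "scaled_entries n \<phi> = (\<lambda>(i, j) t. complex_of_real (sqrt (real n)) * \<phi> t $$ (i, j))"

end

theory Submission
  imports Defs
begin

text \<open>
  The upper bound compares three norms. The Cauchy-Schwarz inequality on the diagonal of \<open>|a|\<close> gives
  \<open>tr |a| \<le> \<surd>n \<parallel>a\<parallel>\<close> with the Hilbert-Schmidt norm on the right (\<open>trace_abs_le_hilbert_schmidt\<close>). Since
  the functions \<open>\<surd>n \<phi>\<^sub>i\<^sub>j\<close> are orthonormal, \<open>tr (a \<phi>)\<close> has \<open>L\<^sub>2\<close> norm \<open>\<parallel>a\<parallel> / \<surd>n\<close>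
  (\<open>orthonormal_L2_parseval\<close>), and on a probability space this is at most its \<open>L\<^sub>\<infinity>\<close> norm. The work lies
  in the definition of \<open>|a|\<close> as the unique positive square root of \<open>a\<^sup>*a\<close>: its existence and uniqueness
  are derived from the diagonalization of Hermitian matrices.

  For optimality, take \<open>a = 1\<close>, so that \<open>tr |a| = n\<close>. Needed is a \<open>\<phi>\<close> as in the statement whose
  trace is bounded by a constant. Let \<open>\<sigma>\<close> be a random matrix of signs with indices in \<open>{0..n}\<close>.
  A subgaussian tail bound and a union bound over a lattice net show that at least two thirds of
  all sign matrices have operator norm of order \<open>\<surd>n\<close> (\<open>card_bounded_signs\<close>); let \<open>\<sigma>\<close> be uniform on these.
  The norm does not change when a row or a column changes its sign, so the entries of \<open>\<sigma>\<close> stay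
  orthonormal under this conditioning, and exponential moments grow by a factor of at most \<open>3/2\<close>.
  What remains to be tamed is the trace. Remove from the upper left \<open>n \<times> n\<close> block its normalized trace
  and add \<open>\<sigma>\<^sub>n\<^sub>n / \<surd>n\<close> on the diagonal instead:
  with \<open>t\<close> the trace of the block, \<open>\<surd>n \<phi> = \<sigma> + (\<sigma>\<^sub>n\<^sub>n / \<surd>n - t / n) 1\<close> on the first \<open>n\<close> indices.
  This replaces the unit vector in the direction of the trace by the fresh unit vector \<open>\<sigma>\<^sub>n\<^sub>n\<close>, so
  the family stays orthonormal (\<open>entry_coeff_orthonormal\<close>) and hence subgaussian, while \<open>tr \<phi>\<close> is now
  the single sign \<open>\<sigma>\<^sub>n\<^sub>n\<close> (\<open>sign_mat_trace\<close>).
\<close>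

section \<open>Adjoints and the diagonalization of Hermitian matrices\<close>

lemma dim_mat_adjoint [simp]: "dim_row (mat_adjoint A) = dim_col A" "dim_col (mat_adjoint A) = dim_row A"
  by (simp_all add: mat_adjoint_def)

lemma mat_adjoint_carrier: "A \<in> carrier_mat n m \<Longrightarrow> mat_adjoint A \<in> carrier_mat m n"
  by (intro carrier_matI) auto

lemma mat_adjoint_index:
  "A \<in> carrier_mat n m \<Longrightarrow> i < m \<Longrightarrow> j < n \<Longrightarrow> mat_adjoint A $$ (i, j) = cnj (A $$ (j, i))"
  unfolding mat_adjoint_def by (subst mat_of_rows_index) auto

lemma mat_adjoint_adjoint:
  fixes A :: "complex mat"
  assumes A: "A \<in> carrier_mat n m"
  shows "mat_adjoint (mat_adjoint A) = A"
  using A by (intro eq_matI) (auto simp: mat_adjoint_index[OF mat_adjoint_carrier[OF A]] mat_adjoint_index[OF A])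

lemma mult_mat_index:
  "A \<in> carrier_mat n k \<Longrightarrow> B \<in> carrier_mat k m \<Longrightarrow> i < n \<Longrightarrow> j < m \<Longrightarrow>
    (A * B) $$ (i, j) = (\<Sum>l<k. A $$ (i, l) * B $$ (l, j))"
  by (simp add: scalar_prod_def atLeast0LessThan)

lemma mat_adjoint_mult:
  fixes A B :: "complex mat"
  assumes A: "A \<in> carrier_mat n k" and B: "B \<in> carrier_mat k m"
  shows "mat_adjoint (A * B) = mat_adjoint B * mat_adjoint A"
proof (rule eq_matI)
  note AB = mult_carrier_mat[OF A B] 
  show "dim_row (mat_adjoint (A * B)) = dim_row (mat_adjoint B * mat_adjoint A)"
    "dim_col (mat_adjoint (A * B)) = dim_col (mat_adjoint B * mat_adjoint A)"
    using mat_adjoint_carrier[OF A] mat_adjoint_carrier[OF B] mat_adjoint_carrier[OF AB] by auto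
  fix i j assume "i < dim_row (mat_adjoint B * mat_adjoint A)" "j < dim_col (mat_adjoint B * mat_adjoint A)"
  then have ij: "i < m" "j < n" using mat_adjoint_carrier[OF A] mat_adjoint_carrier[OF B] by auto
  show "mat_adjoint (A * B) $$ (i, j) = (mat_adjoint B * mat_adjoint A) $$ (i, j)"
    using ij by (simp add: mat_adjoint_index[OF AB] mult_mat_index[OF A B] mat_adjoint_index[OF A]
      mult_mat_index[OF mat_adjoint_carrier[OF B] mat_adjoint_carrier[OF A]] mat_adjoint_index[OF B] mult.commute
      del: index_mult_mat)
qed

lemma cscalar_prod_sum: "v \<in> carrier_vec n \<Longrightarrow> w \<in> carrier_vec n \<Longrightarrow> v \<bullet>c w = (\<Sum>i<n. v $ i * cnj (w $ i))"
  for v w :: "complex vec"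
  by (simp add: scalar_prod_def atLeast0LessThan)

lemma mult_vec_index:
  "A \<in> carrier_mat n m \<Longrightarrow> v \<in> carrier_vec m \<Longrightarrow> i < n \<Longrightarrow> (A *\<^sub>v v) $ i = (\<Sum>j<m. A $$ (i, j) * v $ j)"
  by (simp add: scalar_prod_def atLeast0LessThan)

lemma mat_adjoint_inner:
  fixes A :: "complex mat"
  assumes A: "A \<in> carrier_mat n m" and v: "v \<in> carrier_vec m" and w: "w \<in> carrier_vec n"
  shows "(A *\<^sub>v v) \<bullet>c w = v \<bullet>c (mat_adjoint A *\<^sub>v w)"
proof -
  have "(A *\<^sub>v v) \<bullet>c w = (\<Sum>i<n. \<Sum>j<m. A $$ (i, j) * v $ j * cnj (w $ i))"
    using A v w by (simp add: cscalar_prod_sum[of _ n] mult_vec_index sum_distrib_right del: index_mult_mat_vec)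
  also have "\<dots> = (\<Sum>j<m. \<Sum>i<n. A $$ (i, j) * v $ j * cnj (w $ i))" by (rule sum.swap)
  also have "\<dots> = v \<bullet>c (mat_adjoint A *\<^sub>v w)"
    using mat_adjoint_carrier[OF A] v w
    by (simp add: cscalar_prod_sum[of _ m] mult_vec_index mat_adjoint_index[OF A] sum_distrib_left mult_ac del: index_mult_mat_vec)
  finally show ?thesis .
qed

lemma cscalar_prod_self: "v \<in> carrier_vec n \<Longrightarrow> v \<bullet>c v = complex_of_real (\<Sum>i<n. (cmod (v $ i))\<^sup>2)"
  by (simp add: cscalar_prod_sum[of _ n] complex_norm_square[symmetric])

lemma adjoint_mult_psd:
  assumes S: "S \<in> carrier_mat k n"
  shows "mat_psd n (mat_adjoint S * S)"
proof -
  note S' = mat_adjoint_carrier[OF S]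
  have "0 \<le> ((mat_adjoint S * S) *\<^sub>v v) \<bullet>c v" if v: "v \<in> carrier_vec n" for v
  proof -
    have Sv: "S *\<^sub>v v \<in> carrier_vec k" using S v by simp
    have "((mat_adjoint S * S) *\<^sub>v v) \<bullet>c v = (S *\<^sub>v v) \<bullet>c (S *\<^sub>v v)"
      using mat_adjoint_inner[OF S' Sv v] assoc_mult_mat_vec[OF S' S v] mat_adjoint_adjoint[OF S] by simp
    then show ?thesis by (simp add: cscalar_prod_self[OF Sv] less_eq_complex_def sum_nonneg)
  qed
  then show ?thesis
    using mult_carrier_mat[OF S' S] mat_adjoint_mult[OF S' S] mat_adjoint_adjoint[OF S] unfolding mat_psd_def by simp
qed

definition real_diag :: "nat \<Rightarrow> (nat \<Rightarrow> real) \<Rightarrow> complex mat" where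
  "real_diag n d = mat n n (\<lambda>(i, j). if i = j then complex_of_real (d i) else 0)"

lemma real_diag_carrier [simp]: "real_diag n d \<in> carrier_mat n n"
  by (simp add: real_diag_def)

lemma real_diag_adjoint: "mat_adjoint (real_diag n d) = real_diag n d"
proof (rule eq_matI)
  fix i j assume "i < dim_row (real_diag n d)" "j < dim_col (real_diag n d)"
  then have "i < n" "j < n" by (auto simp: real_diag_def)
  then show "mat_adjoint (real_diag n d) $$ (i, j) = real_diag n d $$ (i, j)"
    by (subst mat_adjoint_index[OF real_diag_carrier]) (auto simp: real_diag_def)
qed (auto simp: real_diag_def)

lemma real_diag_mult: "real_diag n d * real_diag n d' = real_diag n (\<lambda>i. d i * d' i)"
proof (rule eq_matI)
  fix i j assume "i < dim_row (real_diag n (\<lambda>i. d i * d' i))" "j < dim_col (real_diag n (\<lambda>i. d i * d' i))"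
  then have ij: "i < n" "j < n" by (auto simp: real_diag_def)
  have "(real_diag n d * real_diag n d') $$ (i, j) = (\<Sum>l<n. real_diag n d $$ (i, l) * real_diag n d' $$ (l, j))"
    by (rule mult_mat_index[OF real_diag_carrier real_diag_carrier ij])
  also have "\<dots> = (\<Sum>l<n. if l = i then complex_of_real (d i) * real_diag n d' $$ (i, j) else 0)"
    using ij by (intro sum.cong) (auto simp: real_diag_def)
  also have "\<dots> = real_diag n (\<lambda>i. d i * d' i) $$ (i, j)"
    using ij by (auto simp: real_diag_def)
  finally show "(real_diag n d * real_diag n d') $$ (i, j) = real_diag n (\<lambda>i. d i * d' i) $$ (i, j)" .
qed (auto simp: real_diag_def)

lemma exists_eigenvector:
  fixes A :: "complex mat"
  assumes A: "A \<in> carrier_mat n n" and n: "n \<noteq> 0"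
  obtains e v where "v \<in> carrier_vec n" "v \<noteq> 0\<^sub>v n" "A *\<^sub>v v = e \<cdot>\<^sub>v v"
proof -
  have "degree (char_poly A) \<noteq> 0" using degree_monic_char_poly[OF A] n by simp
  then have "\<not> constant (poly (char_poly A))" by (simp add: constant_degree)
  then obtain e where "poly (char_poly A) e = 0" using fundamental_theorem_of_algebra by blast
  then have "eigenvalue A e" using eigenvalue_root_char_poly[OF A] by simp
  then show ?thesis using A that unfolding eigenvalue_def eigenvector_def by auto
qed

text \<open>Gram-Schmidt applied to a basis that starts with \<open>v\<close> keeps \<open>v\<close> as first vector; dividing the columns
by their norms makes them orthonormal.\<close>
lemma exists_unitary_first_column:
  fixes v :: "complex vec"
  assumes v: "v \<in> carrier_vec n" and v0: "v \<noteq> 0\<^sub>v n" and n: "n \<noteq> 0"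
  obtains W c where "W \<in> carrier_mat n n" "mat_adjoint W * W = 1\<^sub>m n" "col W 0 = c \<cdot>\<^sub>v v"
proof -
  interpret cof_vec_space n "TYPE(complex)" .
  define b where "b = basis_completion v"
  define ws where "ws = gram_schmidt n b"
  from basis_completion[OF v v0, folded b_def]
  have dist_b: "distinct b" and indep: "\<not> lin_dep (set b)" and b: "set b \<subseteq> carrier_vec n"
    and hdb: "hd b = v" and len_b: "length b = n" by auto
  from hdb len_b n obtain vs where bv: "b = v # vs" by (cases b) auto
  from gram_schmidt_result[OF b dist_b indep refl, folded ws_def]
  have ws: "set ws \<subseteq> carrier_vec n" "corthogonal ws" "length ws = n" by (auto simp: len_b)
  have "hd ws = v" using gram_schmidt_hd[OF v, of vs, folded bv] by (simp add: ws_def)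
  then have ws0: "ws ! 0 = v" using ws(3) n by (cases ws) auto
  have wsc: "ws ! j \<in> carrier_vec n" if "j < n" for j using ws that by auto
  define N where "N j = sqrt (\<Sum>k<n. (cmod (ws ! j $ k))\<^sup>2)" for j
  have N2: "ws ! j \<bullet>c ws ! j = complex_of_real (N j * N j)" if "j < n" for j
    unfolding cscalar_prod_self[OF wsc[OF that]] by (simp add: N_def sum_nonneg)
  have N: "N j \<noteq> 0" if "j < n" for j
    using N2[OF that] corthogonalD[OF ws(2), of j j] that ws(3) by auto
  define W where "W = mat n n (\<lambda>(i, j). ws ! j $ i / complex_of_real (N j))"
  have W: "W \<in> carrier_mat n n" by (simp add: W_def)
  note W' = mat_adjoint_carrier[OF W]
  have "mat_adjoint W * W = 1\<^sub>m n"
  proof (rule eq_matI)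
    fix i j assume "i < dim_row (1\<^sub>m n)" "j < dim_col (1\<^sub>m n)"
    then have ij: "i < n" "j < n" by auto
    have "(mat_adjoint W * W) $$ (i, j) = (\<Sum>k<n. cnj (W $$ (k, i)) * W $$ (k, j))"
      using ij by (simp add: mult_mat_index[OF W' W] mat_adjoint_index[OF W] del: index_mult_mat)
    also have "\<dots> = (\<Sum>k<n. ws ! j $ k * cnj (ws ! i $ k) / (complex_of_real (N i) * complex_of_real (N j)))"
      using ij by (intro sum.cong) (auto simp: W_def)
    also have "\<dots> = (ws ! j \<bullet>c ws ! i) / (complex_of_real (N i) * complex_of_real (N j))"
      by (simp add: cscalar_prod_sum[OF wsc[OF ij(2)] wsc[OF ij(1)]] sum_divide_distrib)
    also have "\<dots> = (if i = j then 1 else 0)"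
      using N2[OF ij(1)] N[OF ij(1)] corthogonalD[OF ws(2), of j i] ij ws(3) by auto
    finally show "(mat_adjoint W * W) $$ (i, j) = 1\<^sub>m n $$ (i, j)" using ij by simp
  qed (use W W' in auto)
  moreover have "col W 0 = (1 / complex_of_real (N 0)) \<cdot>\<^sub>v v"
    using n v by (intro eq_vecI) (auto simp: W_def ws0)
  ultimately show ?thesis using that W by blast
qed

text \<open>Induction by deflation. In an orthonormal basis that starts with an eigenvector the first column of
\<open>A\<close> vanishes below the diagonal; being Hermitian, \<open>A\<close> then splits into a \<open>1 \<times> 1\<close> block and a smaller
Hermitian block.\<close>
theorem hermitian_diagonalization:
  fixes A :: "complex mat"
  assumes "A \<in> carrier_mat n n" "mat_adjoint A = A"
  shows "\<exists>U d. U \<in> carrier_mat n n \<and> mat_adjoint U * U = 1\<^sub>m n \<and> A = U * real_diag n d * mat_adjoint U"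
  using assms
proof (induction n arbitrary: A)
  case 0
  then show ?case
    by (intro exI[of _ "1\<^sub>m 0"] exI[of _ "\<lambda>_. 0"] conjI) (auto intro!: eq_matI simp: mat_adjoint_def)
next
  case (Suc k)
  let ?n = "Suc k"
  note A = Suc.prems(1)
  obtain e v where v: "v \<in> carrier_vec ?n" "v \<noteq> 0\<^sub>v ?n" and Av: "A *\<^sub>v v = e \<cdot>\<^sub>v v"
    using exists_eigenvector[OF A] by blast
  obtain W c where W: "W \<in> carrier_mat ?n ?n" and W1: "mat_adjoint W * W = 1\<^sub>m ?n" and W0: "col W 0 = c \<cdot>\<^sub>v v"
    using exists_unitary_first_column[OF v] by blast
  note W' = mat_adjoint_carrier[OF W]
  have W2: "W * mat_adjoint W = 1\<^sub>m ?n" using mat_mult_left_right_inverse[OF W' W W1] .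
  define B where "B = mat_adjoint W * (A * W)"
  have B: "B \<in> carrier_mat ?n ?n" using mult_carrier_mat[OF W' mult_carrier_mat[OF A W]] by (simp add: B_def)
  have AW: "A * W \<in> carrier_mat ?n ?n" using A W by simp
  have BH: "mat_adjoint B = B"
    using A W W' by (simp add: B_def mat_adjoint_mult[OF W' AW] mat_adjoint_mult[OF A W]
        mat_adjoint_adjoint[OF W] Suc.prems(2) assoc_mult_mat[OF W' A W])
  have AB: "A = W * B * mat_adjoint W"
  proof -
    have "W * B = (W * mat_adjoint W) * (A * W)"
      unfolding B_def using assoc_mult_mat[OF W W' AW] by simp
    then have "W * B * mat_adjoint W = A * W * mat_adjoint W"
      unfolding W2 left_mult_one_mat[OF AW] by simp
    also have "\<dots> = A" using assoc_mult_mat[OF A W W'] W2 A by simp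
    finally show ?thesis by simp
  qed
  have B0: "B $$ (i, 0) = (if i = 0 then e else 0)" if i: "i < ?n" for i
  proof -
    have AWl: "(A * W) $$ (l, 0) = e * W $$ (l, 0)" if l: "l < ?n" for l
    proof -
      have "(A * W) $$ (l, 0) = (A *\<^sub>v col W 0) $ l" using A W l by simp
      also have "A *\<^sub>v col W 0 = e \<cdot>\<^sub>v col W 0"
        unfolding W0 using mult_mat_vec[OF A v(1)] Av by (simp add: smult_smult_assoc mult.commute)
      finally show ?thesis using W l by simp
    qed
    have "B $$ (i, 0) = (\<Sum>l<?n. mat_adjoint W $$ (i, l) * (e * W $$ (l, 0)))"
      unfolding B_def using i by (subst mult_mat_index[OF W' AW]) (auto simp: AWl simp del: index_mult_mat(1))
    also have "\<dots> = e * (mat_adjoint W * W) $$ (i, 0)"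
      by (simp only: mult_mat_index[OF W' W i zero_less_Suc] sum_distrib_left mult_ac)
    finally show ?thesis using i by (simp add: W1)
  qed
  have B0': "B $$ (0, j) = (if j = 0 then e else 0)" if j: "j < ?n" for j
    using mat_adjoint_index[OF B, of 0 j] B0[OF j] BH B0[of 0] mat_adjoint_index[OF B, of 0 0] j by auto
  have e: "e = complex_of_real (Re e)"
    using mat_adjoint_index[OF B, of 0 0] BH B0[of 0] by (simp add: complex_eq_iff)
  define B3 where "B3 = mat k k (\<lambda>(i, j). B $$ (Suc i, Suc j))"
  have B3: "B3 \<in> carrier_mat k k" by (simp add: B3_def)
  have "mat_adjoint B3 = B3"
  proof (rule eq_matI)
    fix i j assume "i < dim_row B3" "j < dim_col B3"
    then have ij: "i < k" "j < k" using B3 by auto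
    have "cnj (B $$ (Suc j, Suc i)) = B $$ (Suc i, Suc j)"
      using mat_adjoint_index[OF B, of "Suc i" "Suc j"] BH ij by simp
    then show "mat_adjoint B3 $$ (i, j) = B3 $$ (i, j)"
      using ij by (simp add: mat_adjoint_index[OF B3]) (simp add: B3_def)
  qed (use mat_adjoint_carrier[OF B3] B3 in auto)
  then obtain V d where V: "V \<in> carrier_mat k k" and VV: "mat_adjoint V * V = 1\<^sub>m k"
    and BV: "B3 = V * real_diag k d * mat_adjoint V"
    using Suc.IH[OF B3] by blast
  note V' = mat_adjoint_carrier[OF V]
  \<comment> \<open>The direct sum of a scalar and a smaller matrix; products and adjoints are taken blockwise.\<close>
  define blk where "blk x D = four_block_mat (mat 1 1 (\<lambda>_. x)) (0\<^sub>m 1 k) (0\<^sub>m k 1) D"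
    for x :: complex and D :: "complex mat"
  have blk: "blk x D \<in> carrier_mat ?n ?n" if "D \<in> carrier_mat k k" for x D
    using four_block_carrier_mat[of "mat 1 1 (\<lambda>_. x)" 1 1 D k k] that by (simp add: blk_def)
  have blk_index: "blk x D $$ (i, j) = (if i = 0 \<and> j = 0 then x else if i = 0 \<or> j = 0 then 0 else D $$ (i - 1, j - 1))"
    if "D \<in> carrier_mat k k" "i < ?n" "j < ?n" for x D i j
    using that unfolding blk_def by auto
  have blk_mult: "blk x D * blk x' D' = blk (x * x') (D * D')"
    if "D \<in> carrier_mat k k" "D' \<in> carrier_mat k k" for x x' D D'
  proof -
    have "mat 1 1 (\<lambda>_. x) * mat 1 1 (\<lambda>_. x') = mat 1 1 (\<lambda>_. x * x')"
      by (intro eq_matI) (auto simp: scalar_prod_def)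
    then show ?thesis
      unfolding blk_def using that by (subst mult_four_block_mat[of _ 1 1 _ k _ k _ _ 1 _ k]) auto
  qed
  have blk_adj: "mat_adjoint (blk x D) = blk (cnj x) (mat_adjoint D)" if D: "D \<in> carrier_mat k k" for x D
  proof (rule eq_matI)
    note D' = mat_adjoint_carrier[OF D]
    show "dim_row (mat_adjoint (blk x D)) = dim_row (blk (cnj x) (mat_adjoint D))"
      "dim_col (mat_adjoint (blk x D)) = dim_col (blk (cnj x) (mat_adjoint D))"
      using blk[OF D, of x] blk[OF D', of "cnj x"] mat_adjoint_carrier[OF blk[OF D, of x]] by auto
    fix i j assume "i < dim_row (blk (cnj x) (mat_adjoint D))" "j < dim_col (blk (cnj x) (mat_adjoint D))"
    then have ij: "i < ?n" "j < ?n" using blk[OF D', of "cnj x"] by auto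
    then show "mat_adjoint (blk x D) $$ (i, j) = blk (cnj x) (mat_adjoint D) $$ (i, j)"
      by (auto simp: mat_adjoint_index[OF blk[OF D]] blk_index[OF D] blk_index[OF D'] mat_adjoint_index[OF D])
  qed
  have Bblk: "B = blk e B3"
  proof (rule eq_matI)
    fix i j assume "i < dim_row (blk e B3)" "j < dim_col (blk e B3)"
    then have "i < ?n" "j < ?n" using blk[OF B3, of e] by auto
    moreover have "B3 $$ (i, j) = B $$ (Suc i, Suc j)" if "i < k" "j < k" for i j
      using that by (simp add: B3_def)
    ultimately show "B $$ (i, j) = blk e B3 $$ (i, j)"
      by (cases i; cases j) (simp_all add: blk_index[OF B3] B0 B0')
  qed (use B blk[OF B3, of e] in auto)
  have diag_blk: "blk e (real_diag k d) = real_diag ?n (case_nat (Re e) d)"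
  proof (rule eq_matI)
    fix i j assume "i < dim_row (real_diag ?n (case_nat (Re e) d))" "j < dim_col (real_diag ?n (case_nat (Re e) d))"
    then have "i < ?n" "j < ?n" by (auto simp: real_diag_def)
    moreover have "real_diag m f $$ (i, j) = (if i = j then complex_of_real (f i) else 0)"
      if "i < m" "j < m" for i j m f using that by (simp add: real_diag_def)
    ultimately show "blk e (real_diag k d) $$ (i, j) = real_diag ?n (case_nat (Re e) d) $$ (i, j)"
      using e by (cases i; cases j) (simp_all add: blk_index[OF real_diag_carrier])
  qed (use blk[OF real_diag_carrier, of e d] in \<open>auto simp: real_diag_def\<close>)
  define V1 where "V1 = blk 1 V"
  have V1c: "V1 \<in> carrier_mat ?n ?n" using blk[OF V] by (simp add: V1_def)
  note V1' = mat_adjoint_carrier[OF V1c]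
  have V1a: "mat_adjoint V1 = blk 1 (mat_adjoint V)" by (simp add: V1_def blk_adj[OF V])
  have "mat_adjoint V1 * V1 = blk 1 (1\<^sub>m k)"
    unfolding V1a unfolding V1_def by (simp add: blk_mult[OF V' V] VV)
  also have "\<dots> = 1\<^sub>m ?n"
  proof (rule eq_matI)
    fix i j assume "i < dim_row (1\<^sub>m ?n)" "j < dim_col (1\<^sub>m ?n)"
    then show "blk 1 (1\<^sub>m k) $$ (i, j) = 1\<^sub>m ?n $$ (i, j)" by (auto simp: blk_index)
  qed (use blk[of "1\<^sub>m k" 1] in auto)
  finally have V1u: "mat_adjoint V1 * V1 = 1\<^sub>m ?n" .
  define D where "D = real_diag ?n (case_nat (Re e) d)"
  have D: "D \<in> carrier_mat ?n ?n" by (simp add: D_def)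
  have VD: "V * real_diag k d \<in> carrier_mat k k" using V by simp
  have BV1: "B = V1 * D * mat_adjoint V1"
    unfolding V1a D_def diag_blk[symmetric] Bblk BV unfolding V1_def
    by (simp add: blk_mult[OF V real_diag_carrier] blk_mult[OF VD V'])
  define U where "U = W * V1"
  have U: "U \<in> carrier_mat ?n ?n" using W V1c by (simp add: U_def)
  have Ua: "mat_adjoint U = mat_adjoint V1 * mat_adjoint W" by (simp add: U_def mat_adjoint_mult[OF W V1c])
  have "mat_adjoint U * U = mat_adjoint V1 * ((mat_adjoint W * W) * V1)"
    unfolding Ua unfolding U_def
    using assoc_mult_mat[OF V1' W' mult_carrier_mat[OF W V1c]] assoc_mult_mat[OF W' W V1c] by simp
  also have "\<dots> = 1\<^sub>m ?n" using W1 V1u V1c by simp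
  finally have "mat_adjoint U * U = 1\<^sub>m ?n" .
  moreover have "A = U * D * mat_adjoint U"
  proof -
    have "A = W * (V1 * D * mat_adjoint V1) * mat_adjoint W"
      using AB BV1 by simp
    also have "\<dots> = U * D * mat_adjoint U"
      unfolding Ua unfolding U_def using W W' V1c V1' D by (simp add: assoc_mult_mat[of _ ?n ?n _ ?n _ ?n])
    finally show ?thesis .
  qed
  ultimately show ?case using U unfolding D_def by blast
qed

section \<open>Positive square roots and the trace of the absolute value\<close>

lemma unitary_col_norm:
  fixes U :: "complex mat"
  assumes U: "U \<in> carrier_mat n n" and U1: "mat_adjoint U * U = 1\<^sub>m n" and i: "i < n"
  shows "col U i \<bullet>c col U i = 1"
proof -
  have "col U i \<bullet>c col U i = (\<Sum>k<n. mat_adjoint U $$ (i, k) * U $$ (k, i))"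
    using U i by (subst cscalar_prod_sum[of _ n]) (auto simp: mat_adjoint_index[OF U] mult.commute)
  also have "\<dots> = (mat_adjoint U * U) $$ (i, i)"
    by (rule mult_mat_index[OF mat_adjoint_carrier[OF U] U i i, symmetric])
  finally show ?thesis using i by (simp add: U1)
qed

lemma hermitian_eigen_col:
  assumes U: "U \<in> carrier_mat n n" and U1: "mat_adjoint U * U = 1\<^sub>m n" and i: "i < n"
  shows "(U * real_diag n d * mat_adjoint U) *\<^sub>v col U i = complex_of_real (d i) \<cdot>\<^sub>v col U i"
proof -
  note U' = mat_adjoint_carrier[OF U]
  have UD: "U * real_diag n d \<in> carrier_mat n n" by (rule mult_carrier_mat[OF U real_diag_carrier])
  have UDU: "U * real_diag n d * mat_adjoint U \<in> carrier_mat n n" by (rule mult_carrier_mat[OF UD U'])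
  have "(U * real_diag n d * mat_adjoint U) *\<^sub>v col U i = col (U * real_diag n d * mat_adjoint U * U) i"
    by (rule col_mult2[OF UDU U i, symmetric])
  also have "U * real_diag n d * mat_adjoint U * U = U * real_diag n d"
    using assoc_mult_mat[OF UD U' U] right_mult_one_mat[OF UD] by (simp add: U1)
  also have "col (U * real_diag n d) i = complex_of_real (d i) \<cdot>\<^sub>v col U i"
  proof (rule eq_vecI)
    fix k assume "k < dim_vec (complex_of_real (d i) \<cdot>\<^sub>v col U i)"
    then have k: "k < n" using U by simp
    have "col (U * real_diag n d) i $ k = (\<Sum>l<n. U $$ (k, l) * real_diag n d $$ (l, i))"
      unfolding mult_mat_index[OF U real_diag_carrier k i, symmetric]
      using carrier_matD[OF UD] k i by (intro index_col) auto
    also have "\<dots> = (\<Sum>l<n. if l = i then U $$ (k, i) * complex_of_real (d i) else 0)"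
      using i by (intro sum.cong) (auto simp: real_diag_def)
    finally show "col (U * real_diag n d) i $ k = (complex_of_real (d i) \<cdot>\<^sub>v col U i) $ k"
      using i k U by simp
  qed (use U in simp)
  finally show ?thesis .
qed

lemma hermitian_form_col:
  assumes U: "U \<in> carrier_mat n n" and U1: "mat_adjoint U * U = 1\<^sub>m n" and i: "i < n"
  shows "((U * real_diag n d * mat_adjoint U) *\<^sub>v col U i) \<bullet>c col U i = complex_of_real (d i)"
  using unitary_col_norm[OF U U1 i] U i by (simp add: hermitian_eigen_col[OF U U1 i])

lemma mult_mat_regroup:
  assumes "A \<in> carrier_mat n n" "B \<in> carrier_mat n n" "C \<in> carrier_mat n n" "D \<in> carrier_mat n n"
  shows "A * B * (C * D) = A * (B * C) * D"
  using assoc_mult_mat[OF mult_carrier_mat[OF assms(1,2)] assms(3,4)] assoc_mult_mat[OF assms(1-3)] by simp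

text \<open>Taking square roots of the eigenvalues gives \<open>R\<close> with \<open>R\<^sup>2 = A\<close>. Positivity of \<open>R\<close> is seen by taking roots
once more: \<open>R = S\<^sup>*S\<close> with fourth roots of the eigenvalues in \<open>S\<close>.\<close>
lemma mat_psd_sqrt_exists:
  assumes P: "mat_psd n A"
  shows "\<exists>R. mat_psd n R \<and> R * R = A"
proof -
  have A: "A \<in> carrier_mat n n" and AH: "mat_adjoint A = A"
    and pos: "\<And>v. v \<in> carrier_vec n \<Longrightarrow> 0 \<le> (A *\<^sub>v v) \<bullet>c v"
    using P by (auto simp: mat_psd_def)
  obtain U d where U: "U \<in> carrier_mat n n" and U1: "mat_adjoint U * U = 1\<^sub>m n"
    and AU: "A = U * real_diag n d * mat_adjoint U"
    using hermitian_diagonalization[OF A AH] by blast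
  note U' = mat_adjoint_carrier[OF U]
  have d: "0 \<le> d i" if i: "i < n" for i
    using pos[of "col U i"] hermitian_form_col[OF U U1 i, of d] U i by (simp add: AU less_eq_complex_def)
  define S where "S = real_diag n (\<lambda>i. sqrt (sqrt (d i))) * mat_adjoint U"
  have S: "S \<in> carrier_mat n n" unfolding S_def by (rule mult_carrier_mat[OF real_diag_carrier U'])
  define R where "R = U * real_diag n (\<lambda>i. sqrt (d i)) * mat_adjoint U"
  have "mat_adjoint S * S = U * (real_diag n (\<lambda>i. sqrt (sqrt (d i))) * real_diag n (\<lambda>i. sqrt (sqrt (d i)))) * mat_adjoint U"
    unfolding S_def mat_adjoint_mult[OF real_diag_carrier U'] mat_adjoint_adjoint[OF U] real_diag_adjoint
    by (rule mult_mat_regroup[OF U real_diag_carrier real_diag_carrier U'])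
  also have "real_diag n (\<lambda>i. sqrt (sqrt (d i))) * real_diag n (\<lambda>i. sqrt (sqrt (d i))) = real_diag n (\<lambda>i. sqrt (d i))"
    unfolding real_diag_mult using d by (intro eq_matI) (auto simp: real_diag_def)
  finally have "R = mat_adjoint S * S" by (simp add: R_def)
  then have "mat_psd n R" using adjoint_mult_psd[OF S] by simp
  moreover have "R * R = A"
  proof -
    define E where "E = real_diag n (\<lambda>i. sqrt (d i))"
    have E: "E \<in> carrier_mat n n" by (simp add: E_def)
    note UE = mult_carrier_mat[OF U E] and EU = mult_carrier_mat[OF E U']
    have "R * R = U * E * mat_adjoint U * (U * (E * mat_adjoint U))"
      unfolding R_def E_def[symmetric] assoc_mult_mat[OF U E U', symmetric] ..
    also have "\<dots> = U * E * (mat_adjoint U * U) * (E * mat_adjoint U)"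
      by (rule mult_mat_regroup[OF UE U' U EU])
    also have "\<dots> = U * E * (E * mat_adjoint U)"
      unfolding U1 right_mult_one_mat[OF UE] ..
    also have "\<dots> = U * (E * E) * mat_adjoint U"
      by (rule mult_mat_regroup[OF U E E U'])
    also have "E * E = real_diag n d"
      unfolding E_def real_diag_mult using d by (intro eq_matI) (auto simp: real_diag_def)
    finally show ?thesis by (simp add: AU)
  qed
  ultimately show ?thesis by blast
qed

text \<open>Let \<open>D = P - Q\<close> and let \<open>u\<close> be a unit eigenvector of \<open>D\<close> with eigenvalue \<open>d\<close>, so \<open>Pu = Qu + du\<close>. Since
\<open>P\<^sup>2 = Q\<^sup>2\<close>, the vectors \<open>Pu\<close> and \<open>Qu\<close> have equal norms, and expanding this gives
\<open>d (\<langle>Pu, u\<rangle> + \<langle>Qu, u\<rangle>) = 0\<close>. If \<open>d \<noteq> 0\<close>, both nonnegative summands vanish, but their difference is \<open>d\<close>.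
So all eigenvalues of the Hermitian matrix \<open>D\<close> are zero.\<close>
lemma mat_psd_sqrt_unique:
  assumes P: "mat_psd n P" and Q: "mat_psd n Q" and eq: "P * P = Q * Q"
  shows "P = Q"
proof -
  have Pc: "P \<in> carrier_mat n n" and PH: "mat_adjoint P = P"
    and Ppos: "\<And>v. v \<in> carrier_vec n \<Longrightarrow> 0 \<le> (P *\<^sub>v v) \<bullet>c v"
    and Qc: "Q \<in> carrier_mat n n" and QH: "mat_adjoint Q = Q"
    and Qpos: "\<And>v. v \<in> carrier_vec n \<Longrightarrow> 0 \<le> (Q *\<^sub>v v) \<bullet>c v"
    using P Q by (auto simp: mat_psd_def)
  define D where "D = P - Q"
  have D: "D \<in> carrier_mat n n" unfolding D_def by (rule minus_carrier_mat[OF Qc])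
  have "mat_adjoint D = D"
  proof (rule eq_matI)
    fix i j assume "i < dim_row D" "j < dim_col D"
    then have ij: "i < n" "j < n" using D by auto
    have "cnj (P $$ (j, i)) = P $$ (i, j)" "cnj (Q $$ (j, i)) = Q $$ (i, j)"
      using mat_adjoint_index[OF Pc ij] mat_adjoint_index[OF Qc ij] PH QH by auto
    then show "mat_adjoint D $$ (i, j) = D $$ (i, j)"
      unfolding mat_adjoint_index[OF D ij] using ij Pc Qc by (simp add: D_def)
  qed (use D in auto)
  then obtain U d where U: "U \<in> carrier_mat n n" and U1: "mat_adjoint U * U = 1\<^sub>m n"
    and DU: "D = U * real_diag n d * mat_adjoint U"
    using hermitian_diagonalization[OF D] by blast
  have "d i = 0" if i: "i < n" for i
  proof -
    define u where "u = col U i"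
    have u: "u \<in> carrier_vec n" using U i by (simp add: u_def)
    have Pu: "P *\<^sub>v u \<in> carrier_vec n" and Qu: "Q *\<^sub>v u \<in> carrier_vec n" using Pc Qc u by auto
    have Du: "D *\<^sub>v u = complex_of_real (d i) \<cdot>\<^sub>v u"
      using hermitian_eigen_col[OF U U1 i, of d] by (simp add: DU u_def)
    have uu: "u \<bullet>c u = 1" unfolding u_def by (rule unitary_col_norm[OF U U1 i])
    define p where "p = (P *\<^sub>v u) \<bullet>c u"
    define q where "q = (Q *\<^sub>v u) \<bullet>c u"
    have PQu: "P *\<^sub>v u = Q *\<^sub>v u + complex_of_real (d i) \<cdot>\<^sub>v u"
    proof -
      have "D *\<^sub>v u = P *\<^sub>v u - Q *\<^sub>v u" unfolding D_def by (rule minus_mult_distrib_mat_vec[OF Pc Qc u])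
      then have "complex_of_real (d i) \<cdot>\<^sub>v u = P *\<^sub>v u - Q *\<^sub>v u" by (simp only: Du)
      moreover have "x = y + z" if "z = x - y" "x \<in> carrier_vec n" "y \<in> carrier_vec n" for x y z :: "complex vec"
        using that by (intro eq_vecI) auto
      ultimately show ?thesis using Pu Qu by blast
    qed
    have pq: "p = q + d i"
      unfolding p_def q_def PQu using uu u Qu by (simp add: add_scalar_prod_distrib[of _ n])
    have real: "Im q = 0" "0 \<le> Re q" "0 \<le> Re p"
      using Ppos[OF u] Qpos[OF u] by (auto simp: p_def q_def less_eq_complex_def)
    have uQ: "u \<bullet>c (Q *\<^sub>v u) = q"
      using mat_adjoint_inner[OF Qc u u] by (simp add: q_def QH)
    have "(P *\<^sub>v u) \<bullet>c (P *\<^sub>v u) = ((P * P) *\<^sub>v u) \<bullet>c u"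
      using mat_adjoint_inner[OF Pc Pu u] Pc u by (simp add: PH)
    also have "\<dots> = (Q *\<^sub>v u) \<bullet>c (Q *\<^sub>v u)"
      unfolding eq using mat_adjoint_inner[OF Qc Qu u] Qc u by (simp add: QH)
    finally have "(Q *\<^sub>v u + complex_of_real (d i) \<cdot>\<^sub>v u) \<bullet>c (Q *\<^sub>v u + complex_of_real (d i) \<cdot>\<^sub>v u) =
        (Q *\<^sub>v u) \<bullet>c (Q *\<^sub>v u)" by (simp only: PQu)
    then have "d i * (2 * q + d i) = 0"
      using u Qu by (simp add: conjugate_add_vec[of _ n] conjugate_smult_vec add_scalar_prod_distrib[of _ n]
        scalar_prod_add_distrib[of _ n] uQ uu q_def[symmetric] algebra_simps)
    then have "d i = 0 \<or> 2 * q + d i = 0" by simp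
    then show "d i = 0"
      using pq real by (auto simp: complex_eq_iff)
  qed
  then have "real_diag n d = 0\<^sub>m n n" by (intro eq_matI) (auto simp: real_diag_def)
  then have "D = 0\<^sub>m n n" using U mat_adjoint_carrier[OF U] by (simp add: DU)
  moreover have "D $$ (i, j) = P $$ (i, j) - Q $$ (i, j)" if "i < n" "j < n" for i j
    unfolding D_def using that Pc Qc by simp
  ultimately have "P $$ (i, j) = Q $$ (i, j)" if "i < n" "j < n" for i j
    using that by simp
  then show ?thesis using Pc Qc by (intro eq_matI) auto
qed

lemma mat_sqrt_eqI: "mat_psd n P \<Longrightarrow> P * P = A \<Longrightarrow> A \<in> carrier_mat n n \<Longrightarrow> mat_sqrt A = P"
  unfolding mat_sqrt_def by (rule the_equality) (auto intro: mat_psd_sqrt_unique)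

lemma mat_abs_psd:
  assumes A: "A \<in> carrier_mat n n"
  shows "mat_psd n (mat_abs A)" "mat_abs A * mat_abs A = mat_adjoint A * A"
proof -
  have "mat_adjoint A * A \<in> carrier_mat n n" by (rule mult_carrier_mat[OF mat_adjoint_carrier[OF A] A])
  moreover obtain R where "mat_psd n R" "R * R = mat_adjoint A * A"
    using mat_psd_sqrt_exists[OF adjoint_mult_psd[OF A]] by blast
  ultimately show "mat_psd n (mat_abs A)" "mat_abs A * mat_abs A = mat_adjoint A * A"
    using mat_sqrt_eqI[of n R] unfolding mat_abs_def by auto
qed

lemma trace_adjoint_mult:
  assumes A: "A \<in> carrier_mat n n"
  shows "mat_trace (mat_adjoint A * A) = complex_of_real (\<Sum>i<n. \<Sum>j<n. (cmod (A $$ (i, j)))\<^sup>2)"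
proof -
  note A' = mat_adjoint_carrier[OF A]
  have "mat_trace (mat_adjoint A * A) = (\<Sum>j<n. (mat_adjoint A * A) $$ (j, j))"
    using A by (simp add: mat_trace_def)
  also have "\<dots> = (\<Sum>j<n. \<Sum>i<n. A $$ (i, j) * cnj (A $$ (i, j)))"
  proof (rule sum.cong)
    fix j assume "j \<in> {..<n}"
    then have j: "j < n" by simp
    show "(mat_adjoint A * A) $$ (j, j) = (\<Sum>i<n. A $$ (i, j) * cnj (A $$ (i, j)))"
      unfolding mult_mat_index[OF A' A j j] by (intro sum.cong) (simp_all add: mat_adjoint_index[OF A j] mult.commute)
  qed simp
  also have "\<dots> = (\<Sum>i<n. \<Sum>j<n. A $$ (i, j) * cnj (A $$ (i, j)))" by (rule sum.swap)
  finally show ?thesis by (simp add: complex_norm_square[symmetric])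
qed

text \<open>The Hilbert-Schmidt norms of \<open>a\<close> and \<open>|a|\<close> agree because \<open>|a|\<^sup>2 = a\<^sup>*a\<close>, and the trace of \<open>|a|\<close> sees only
its \<open>n\<close> diagonal entries.\<close>
lemma trace_abs_le_hilbert_schmidt:
  assumes A: "A \<in> carrier_mat n n"
  shows "Re (mat_trace (mat_abs A)) \<le> sqrt n * sqrt (\<Sum>i<n. \<Sum>j<n. (cmod (A $$ (i, j)))\<^sup>2)"
proof -
  define P where "P = mat_abs A"
  have P: "P \<in> carrier_mat n n" "mat_adjoint P = P" "P * P = mat_adjoint A * A"
    using mat_abs_psd[OF A] by (auto simp: P_def mat_psd_def)
  have "complex_of_real (\<Sum>i<n. \<Sum>j<n. (cmod (P $$ (i, j)))\<^sup>2) = complex_of_real (\<Sum>i<n. \<Sum>j<n. (cmod (A $$ (i, j)))\<^sup>2)"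
    using trace_adjoint_mult[OF A] trace_adjoint_mult[OF P(1)] P by metis
  then have HS: "(\<Sum>i<n. \<Sum>j<n. (cmod (P $$ (i, j)))\<^sup>2) = (\<Sum>i<n. \<Sum>j<n. (cmod (A $$ (i, j)))\<^sup>2)"
    by (simp only: of_real_eq_iff)
  have "Re (mat_trace P) = (\<Sum>i<n. 1 * Re (P $$ (i, i)))" using P(1) by (simp add: mat_trace_def)
  also have "\<dots> \<le> sqrt ((\<Sum>i<n. 1\<^sup>2) * (\<Sum>i<n. (Re (P $$ (i, i)))\<^sup>2))"
    by (intro real_le_rsqrt Cauchy_Schwarz_ineq_sum)
  also have "\<dots> = sqrt (\<Sum>i<n. 1\<^sup>2) * sqrt (\<Sum>i<n. (Re (P $$ (i, i)))\<^sup>2)"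
    by (rule real_sqrt_mult)
  also have "\<dots> \<le> sqrt n * sqrt (\<Sum>i<n. \<Sum>j<n. (cmod (P $$ (i, j)))\<^sup>2)"
  proof -
    have "(Re (P $$ (i, i)))\<^sup>2 \<le> (\<Sum>j<n. (cmod (P $$ (i, j)))\<^sup>2)" if "i < n" for i
    proof -
      have "(Re (P $$ (i, i)))\<^sup>2 \<le> (cmod (P $$ (i, i)))\<^sup>2" by (simp add: cmod_power2)
      also have "\<dots> \<le> (\<Sum>j<n. (cmod (P $$ (i, j)))\<^sup>2)" using that by (intro member_le_sum) auto
      finally show ?thesis .
    qed
    then show ?thesis by (intro mult_mono real_sqrt_le_mono sum_mono) (auto simp: sum_nonneg)
  qed
  finally show ?thesis unfolding HS unfolding P_def .
qed

section \<open>The upper bound\<close>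

lemma orthonormal_L2_parseval:
  assumes on: "orthonormal_L2 M I \<psi>" and I: "finite I"
  shows "integrable M (\<lambda>t. (cmod (\<Sum>k\<in>I. c k * \<psi> k t))\<^sup>2)"
    "(LINT t|M. (cmod (\<Sum>k\<in>I. c k * \<psi> k t))\<^sup>2) = (\<Sum>k\<in>I. (cmod (c k))\<^sup>2)"
proof -
  have meas: "\<psi> k \<in> borel_measurable M" and sq: "integrable M (\<lambda>t. (cmod (\<psi> k t))\<^sup>2)" if "k \<in> I" for k
    using on that by (auto simp: orthonormal_L2_def)
  have int: "integrable M (\<lambda>t. \<psi> k t * cnj (\<psi> l t))" if "k \<in> I" "l \<in> I" for k l
  proof (rule Bochner_Integration.integrable_bound)
    show "integrable M (\<lambda>t. (cmod (\<psi> k t))\<^sup>2 + (cmod (\<psi> l t))\<^sup>2)" using sq that by simp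
    have "(\<lambda>t. cnj (\<psi> l t)) \<in> borel_measurable M"
      by (rule borel_measurable_continuous_on[OF _ meas[OF that(2)]]) (intro continuous_intros)
    then show "(\<lambda>t. \<psi> k t * cnj (\<psi> l t)) \<in> borel_measurable M"
      using meas[OF that(1)] by simp
    have "x * y \<le> x\<^sup>2 + y\<^sup>2" for x y :: real
      using sum_squares_bound[of x y] sum_power2_ge_zero[of x y] by linarith
    then show "AE t in M. norm (\<psi> k t * cnj (\<psi> l t)) \<le> norm ((cmod (\<psi> k t))\<^sup>2 + (cmod (\<psi> l t))\<^sup>2)"
      by (auto simp: norm_mult)
  qed
  have expand: "complex_of_real ((cmod (\<Sum>k\<in>I. c k * \<psi> k t))\<^sup>2) =
      (\<Sum>k\<in>I. \<Sum>l\<in>I. c k * cnj (c l) * (\<psi> k t * cnj (\<psi> l t)))" for t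
    by (simp only: complex_norm_square cnj_sum complex_cnj_mult sum_product mult_ac)
  have "integrable M (\<lambda>t. complex_of_real ((cmod (\<Sum>k\<in>I. c k * \<psi> k t))\<^sup>2))"
    unfolding expand using int by auto
  then show "integrable M (\<lambda>t. (cmod (\<Sum>k\<in>I. c k * \<psi> k t))\<^sup>2)"
    by (simp only: complex_of_real_integrable_eq)
  have "complex_of_real (LINT t|M. (cmod (\<Sum>k\<in>I. c k * \<psi> k t))\<^sup>2) =
      (LINT t|M. (\<Sum>k\<in>I. \<Sum>l\<in>I. c k * cnj (c l) * (\<psi> k t * cnj (\<psi> l t))))"
    unfolding expand[symmetric] by (rule integral_complex_of_real[symmetric])
  also have "\<dots> = (\<Sum>k\<in>I. \<Sum>l\<in>I. c k * cnj (c l) * (LINT t|M. \<psi> k t * cnj (\<psi> l t)))"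
    using int by (simp add: Bochner_Integration.integral_sum Bochner_Integration.integrable_sum)
  also have "\<dots> = (\<Sum>k\<in>I. \<Sum>l\<in>I. if l = k then c k * cnj (c k) else 0)"
    using on by (intro sum.cong) (auto simp: orthonormal_L2_def)
  also have "\<dots> = complex_of_real (\<Sum>k\<in>I. (cmod (c k))\<^sup>2)"
    using I by (simp add: complex_norm_square del: of_real_power)
  finally show "(LINT t|M. (cmod (\<Sum>k\<in>I. c k * \<psi> k t))\<^sup>2) = (\<Sum>k\<in>I. (cmod (c k))\<^sup>2)"
    by (simp only: of_real_eq_iff)
qed

lemma trace_mult_scaled_entries:
  assumes a: "a \<in> carrier_mat n n" and F: "\<phi> t \<in> carrier_mat n n" and n: "n \<ge> 1"
  shows "mat_trace (a * \<phi> t) =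
    (\<Sum>k\<in>{..<n} \<times> {..<n}. (a $$ (snd k, fst k) / complex_of_real (sqrt n)) * scaled_entries n \<phi> k t)"
proof -
  have "mat_trace (a * \<phi> t) = (\<Sum>j<n. (a * \<phi> t) $$ (j, j))"
    using a F by (simp add: mat_trace_def)
  also have "\<dots> = (\<Sum>j<n. \<Sum>i<n. a $$ (j, i) * \<phi> t $$ (i, j))"
    using mult_mat_index[OF a F] by (intro sum.cong) auto
  also have "\<dots> = (\<Sum>i<n. \<Sum>j<n. a $$ (j, i) * \<phi> t $$ (i, j))" by (rule sum.swap)
  also have "\<dots> = (\<Sum>k\<in>{..<n} \<times> {..<n}. a $$ (snd k, fst k) * \<phi> t $$ k)"
    by (simp add: sum.cartesian_product case_prod_unfold)
  also have "\<dots> = (\<Sum>k\<in>{..<n} \<times> {..<n}. (a $$ (snd k, fst k) / complex_of_real (sqrt n)) * scaled_entries n \<phi> k t)"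
    using n by (intro sum.cong) (auto simp: scaled_entries_def)
  finally show ?thesis .
qed

lemma trace_abs_le_Linf:
  assumes n: "n \<ge> 1" and M: "prob_space M" and meas: "mat_measurable n M \<phi>"
    and on: "orthonormal_L2 M ({..<n} \<times> {..<n}) (scaled_entries n \<phi>)"
    and a: "a \<in> carrier_mat n n"
  shows "ereal (Re (mat_trace (mat_abs a))) \<le> ereal (real n) * Linf_norm M (\<lambda>t. mat_trace (a * \<phi> t))"
proof -
  interpret prob_space M by (rule M)
  define f where "f t = mat_trace (a * \<phi> t)" for t
  define I where "I = {..<n} \<times> {..<n}"
  define c where "c k = a $$ (snd k, fst k) / complex_of_real (sqrt n)" for k
  define S where "S = (\<Sum>i<n. \<Sum>j<n. (cmod (a $$ (i, j)))\<^sup>2)"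
  have fc: "f t = (\<Sum>k\<in>I. c k * scaled_entries n \<phi> k t)" if "t \<in> space M" for t
    using trace_mult_scaled_entries[OF a, of \<phi> t] n meas that by (simp add: f_def c_def I_def mat_measurable_def)
  note L2 = orthonormal_L2_parseval[OF on, folded I_def, of c]
  have "integrable M (\<lambda>t. (cmod (f t))\<^sup>2) \<longleftrightarrow> integrable M (\<lambda>t. (cmod (\<Sum>k\<in>I. c k * scaled_entries n \<phi> k t))\<^sup>2)"
    by (intro Bochner_Integration.integrable_cong refl) (simp add: fc)
  then have int: "integrable M (\<lambda>t. (cmod (f t))\<^sup>2)" using L2(1) by (simp add: I_def)
  have "(LINT t|M. (cmod (f t))\<^sup>2) = (LINT t|M. (cmod (\<Sum>k\<in>I. c k * scaled_entries n \<phi> k t))\<^sup>2)"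
    by (intro Bochner_Integration.integral_cong refl) (simp add: fc)
  also have "\<dots> = (\<Sum>k\<in>I. (cmod (c k))\<^sup>2)" using L2(2) by (simp add: I_def)
  also have "\<dots> = (\<Sum>k\<in>{..<n} \<times> {..<n}. (cmod (a $$ (snd k, fst k)))\<^sup>2) / n"
    by (simp add: c_def I_def norm_divide power_divide sum_divide_distrib)
  also have "(\<Sum>k\<in>{..<n} \<times> {..<n}. (cmod (a $$ (snd k, fst k)))\<^sup>2) = (\<Sum>j<n. \<Sum>i<n. (cmod (a $$ (i, j)))\<^sup>2)"
    by (simp add: sum.cartesian_product case_prod_unfold)
  also have "\<dots> = S" unfolding S_def by (rule sum.swap)
  finally have norm2: "(LINT t|M. (cmod (f t))\<^sup>2) = S / n" .
  have S: "0 \<le> S" by (simp add: S_def sum_nonneg)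
  have ae: "AE t in M. ereal (cmod (f t)) \<le> Linf_norm M f"
    unfolding Linf_norm_def by (rule esssup_AE)
  have "sqrt n * sqrt S \<le> n * K" if "AE t in M. cmod (f t) \<le> K" for K :: real
  proof -
    have "AE t in M. 0 \<le> K" using that by eventually_elim (smt (verit) norm_ge_zero)
    then have K: "0 \<le> K" by simp
    have "AE t in M. (cmod (f t))\<^sup>2 \<le> K\<^sup>2" using that by eventually_elim (auto intro: power_mono)
    then have "(LINT t|M. (cmod (f t))\<^sup>2) \<le> (LINT t|M. K\<^sup>2)"
      using int by (intro integral_mono_AE) auto
    then have "S / n \<le> K\<^sup>2" by (simp add: norm2 prob_space)
    then have "n * S \<le> (n * K)\<^sup>2" using n by (simp add: field_simps power2_eq_square)
    then have "sqrt (n * S) \<le> n * K" using K by (intro real_le_lsqrt) auto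
    then show ?thesis by (simp add: real_sqrt_mult)
  qed
  then have key: "Re (mat_trace (mat_abs a)) \<le> n * K" if "AE t in M. cmod (f t) \<le> K" for K :: real
    using trace_abs_le_hilbert_schmidt[OF a] that by (auto simp: S_def intro: order_trans)
  show ?thesis
  proof (cases "Linf_norm M f")
    case (real K)
    then have "AE t in M. cmod (f t) \<le> K" using ae by simp
    then show ?thesis using key real by (simp add: f_def[abs_def])
  next
    case PInf
    then show ?thesis using n by (simp add: f_def[abs_def])
  next
    case MInf
    then have "AE t in M. False" using ae by simp
    then show ?thesis by simp
  qed
qed

section \<open>Sums of random signs\<close>

text \<open>Comparison of the power series, using \<open>2\<^sup>k k! \<le> (2k)!\<close>.\<close>
lemma cosh_le_exp_half_square: "cosh x \<le> exp (x\<^sup>2 / 2)" for x :: real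
proof -
  have "(\<lambda>n. if even n then x ^ n /\<^sub>R fact n else 0) sums cosh x"
    by (rule cosh_converges)
  moreover have "(\<lambda>k. if even (2 * k) then x ^ (2 * k) /\<^sub>R fact (2 * k) else 0) sums cosh x \<longleftrightarrow>
      (\<lambda>n. if even n then x ^ n /\<^sub>R fact n else 0) sums cosh x"
  proof (rule sums_mono_reindex)
    fix n assume "n \<notin> range (\<lambda>k::nat. 2 * k)"
    then have "odd n" by (metis dvd_def rangeI)
    then show "(if even n then x ^ n /\<^sub>R fact n else 0) = 0" by simp
  qed (simp add: strict_mono_def)
  moreover have "(\<lambda>k. if even (2 * k) then x ^ (2 * k) /\<^sub>R fact (2 * k) else 0) =
      (\<lambda>k. x ^ (2 * k) / fact (2 * k))"
    by (simp only: dvd_triv_left if_True real_scaleR_def divide_inverse_commute)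
  ultimately have c: "(\<lambda>k. x ^ (2 * k) / fact (2 * k)) sums cosh x"
    by metis
  have e: "(\<lambda>k. (x\<^sup>2 / 2) ^ k / fact k) sums exp (x\<^sup>2 / 2)"
    using exp_converges[of "x\<^sup>2 / 2"] by (simp only: real_scaleR_def divide_inverse_commute)
  have fact_bound: "2 ^ k * fact k \<le> (fact (2 * k) :: real)" for k
  proof (induction k)
    case (Suc k)
    have "(2::real) ^ Suc k * fact (Suc k) = (2 * real k + 2) * (2 ^ k * fact k)"
      by (simp add: algebra_simps)
    also have "\<dots> \<le> (2 * real k + 2) * fact (2 * k)"
      using Suc by (intro mult_left_mono) auto
    also have "\<dots> \<le> (2 * real k + 2) * ((2 * real k + 1) * fact (2 * k))"
      by (intro mult_left_mono) (auto simp: algebra_simps)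
    also have "\<dots> = fact (2 * Suc k)"
      by (simp add: algebra_simps)
    finally show ?case .
  qed simp
  show ?thesis
  proof (rule sums_le[OF _ c e])
    fix k
    have "x ^ (2 * k) / fact (2 * k) \<le> x ^ (2 * k) / (2 ^ k * fact k)"
      using fact_bound[of k] by (intro divide_left_mono) (auto simp: power_mult)
    then show "x ^ (2 * k) / fact (2 * k) \<le> (x\<^sup>2 / 2) ^ k / fact k"
      by (simp add: power_mult power_divide)
  qed
qed

definition signs :: "'i set \<Rightarrow> ('i \<Rightarrow> real) set" where
  "signs I = PiE I (\<lambda>_. {-1, 1})"

lemma finite_signs [simp]: "finite I \<Longrightarrow> finite (signs I)"
  unfolding signs_def by (intro finite_PiE) auto

lemma card_signs: "finite I \<Longrightarrow> card (signs I) = 2 ^ card I"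
proof -
  assume "finite I"
  moreover have "card {-1, 1 :: real} = 2" by simp
  ultimately show ?thesis by (simp only: signs_def card_PiE prod_constant)
qed

lemma signsD: "\<sigma> \<in> signs I \<Longrightarrow> p \<in> I \<Longrightarrow> \<sigma> p = -1 \<or> \<sigma> p = 1"
  unfolding signs_def by (auto simp: PiE_iff)

lemma signs_square: "\<sigma> \<in> signs I \<Longrightarrow> p \<in> I \<Longrightarrow> \<sigma> p * \<sigma> p = 1"
  using signsD[of \<sigma> I p] by auto

lemma sum_signs_insert:
  assumes "finite F" "q \<notin> F"
  shows "(\<Sum>\<sigma>\<in>signs (insert q F). f \<sigma>) = (\<Sum>\<sigma>\<in>signs F. f (\<sigma>(q := -1)) + f (\<sigma>(q := 1)))"
proof -
  have inj: "inj_on (\<lambda>(y, g). g(q := y)) ({-1, 1::real} \<times> signs F)"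
    using assms by (auto simp: inj_on_def signs_def PiE_def extensional_def fun_eq_iff)
      (metis fun_upd_apply)+
  have "(\<Sum>\<sigma>\<in>signs (insert q F). f \<sigma>) = (\<Sum>(y, g)\<in>{-1, 1} \<times> signs F. f (g(q := y)))"
    unfolding signs_def PiE_insert_eq
    by (subst sum.reindex) (use inj in \<open>auto simp: signs_def case_prod_unfold\<close>)
  also have "\<dots> = (\<Sum>y\<in>{-1, 1}. \<Sum>g\<in>signs F. f (g(q := y)))"
    by (simp add: sum.cartesian_product)
  also have "\<dots> = (\<Sum>\<sigma>\<in>signs F. f (\<sigma>(q := -1)) + f (\<sigma>(q := 1)))"
    by (simp add: sum.distrib)
  finally show ?thesis .
qed

text \<open>Averaging out one sign in \<open>exp (s (y \<plusminus> c)\<^sup>2)\<close> leaves an expression of the same kind with a slightly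
larger \<open>s\<close>. This is what makes an induction over the signs possible.\<close>
lemma sum_exp_square_sign:
  fixes s y c :: real
  assumes "0 \<le> s"
  shows "exp (s * (y - c)\<^sup>2) + exp (s * (y + c)\<^sup>2) \<le> 2 * exp (s * c\<^sup>2 + s * (1 + 2 * s * c\<^sup>2) * y\<^sup>2)"
proof -
  have "exp (s * (y - c)\<^sup>2) + exp (s * (y + c)\<^sup>2) =
      2 * (exp (s * y\<^sup>2 + s * c\<^sup>2) * cosh (2 * s * y * c))"
    by (simp add: cosh_def power2_eq_square exp_add[symmetric] algebra_simps)
  also have "\<dots> \<le> 2 * (exp (s * y\<^sup>2 + s * c\<^sup>2) * exp ((2 * s * y * c)\<^sup>2 / 2))"
    by (intro mult_left_mono cosh_le_exp_half_square) auto
  also have "\<dots> = 2 * exp (s * c\<^sup>2 + s * (1 + 2 * s * c\<^sup>2) * y\<^sup>2)"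
    by (simp add: exp_add[symmetric] power2_eq_square algebra_simps)
  finally show ?thesis .
qed

text \<open>The shift \<open>y\<close> serves the induction: it absorbs the sign that is added. The rate evolves by
\<open>s \<mapsto> s (1 + 2sc\<^sup>2) \<le> 1 / (1/s - 2c\<^sup>2)\<close>, so \<open>1/s\<close> decreases by at most \<open>2c\<^sup>2\<close> in each step and by
\<open>2 \<Sum> c\<^sup>2\<close> altogether.\<close>
lemma rademacher_square_mgf_shifted:
  fixes c :: "'i \<Rightarrow> real"
  assumes "finite I" "0 \<le> s" "2 * s * (\<Sum>p\<in>I. (c p)\<^sup>2) < 1"
  shows "(\<Sum>\<sigma>\<in>signs I. exp (s * (y + (\<Sum>p\<in>I. c p * \<sigma> p))\<^sup>2)) \<le>
    2 ^ card I * exp (s / (1 - 2 * s * (\<Sum>p\<in>I. (c p)\<^sup>2)) * (y\<^sup>2 + (\<Sum>p\<in>I. (c p)\<^sup>2)))"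
  using assms(1,3)
proof (induction I arbitrary: y)
  case empty
  then show ?case by (simp add: signs_def)
next
  case (insert q F)
  define S where "S = (\<Sum>p\<in>F. (c p)\<^sup>2)"
  define d where "d = (c q)\<^sup>2"
  define s1 where "s1 = s / (1 - 2 * s * S)"
  define s2 where "s2 = s / (1 - 2 * s * (d + S))"
  have S0: "0 \<le> S" and d0: "0 \<le> d" by (auto simp: S_def d_def sum_nonneg)
  have sum_insert: "(\<Sum>p\<in>insert q F. (c p)\<^sup>2) = d + S"
    using insert by (simp add: S_def d_def)
  have lt: "2 * s * (d + S) < 1" using insert.prems sum_insert by simp
  have sd0: "0 \<le> s * d" using d0 assms(2) by simp
  have lt1: "2 * s * S < 1" using lt sd0 by (simp add: algebra_simps)
  have s1: "0 \<le> s1" using assms(2) lt1 by (simp add: s1_def)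
  have s2: "s1 \<le> s2" unfolding s1_def s2_def
    using assms(2) lt lt1 sd0 by (intro divide_left_mono mult_pos_pos) (auto simp: algebra_simps)
  have s12: "s1 * (1 + 2 * s1 * d) \<le> s2"
  proof -
    define u where "u = 1 - 2 * s * S"
    have u: "0 < u" "0 < u - 2 * s * d" using lt lt1 by (auto simp: u_def algebra_simps)
    have "(1 + 2 * (s * d) / u) * (u - 2 * s * d) = u - (2 * s * d)\<^sup>2 / u"
      using u by (simp add: field_simps power2_eq_square)
    also have "\<dots> \<le> u" using u by simp
    finally have "1 + 2 * (s * d) / u \<le> u / (u - 2 * s * d)"
      using u by (simp add: pos_le_divide_eq)
    then have "s / u * (1 + 2 * (s * d) / u) \<le> s / u * (u / (u - 2 * s * d))"
      using u assms(2) by (intro mult_left_mono) auto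
    moreover have "s1 = s / u" "s2 = s / (u - 2 * s * d)"
      by (simp_all add: s1_def s2_def u_def ring_distribs diff_diff_eq add.commute)
    ultimately show ?thesis using u by (simp add: mult.assoc)
  qed
  have "(\<Sum>\<sigma>\<in>signs (insert q F). exp (s * (y + (\<Sum>p\<in>insert q F. c p * \<sigma> p))\<^sup>2)) =
      (\<Sum>\<sigma>\<in>signs F. exp (s * ((y - c q) + (\<Sum>p\<in>F. c p * \<sigma> p))\<^sup>2)) +
      (\<Sum>\<sigma>\<in>signs F. exp (s * ((y + c q) + (\<Sum>p\<in>F. c p * \<sigma> p))\<^sup>2))"
  proof -
    have "(\<Sum>p\<in>F. c p * (\<sigma>(q := v)) p) = (\<Sum>p\<in>F. c p * \<sigma> p)" for \<sigma> v
      using insert.hyps by (intro sum.cong) auto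
    then show ?thesis
      using insert.hyps by (simp add: sum_signs_insert sum.distrib algebra_simps)
  qed
  also have "\<dots> \<le> 2 ^ card F * exp (s1 * ((y - c q)\<^sup>2 + S)) + 2 ^ card F * exp (s1 * ((y + c q)\<^sup>2 + S))"
    using insert.IH lt1 unfolding s1_def S_def by (intro add_mono) auto
  also have "\<dots> = 2 ^ card F * exp (s1 * S) * (exp (s1 * (y - c q)\<^sup>2) + exp (s1 * (y + c q)\<^sup>2))"
    by (simp only: exp_add ring_distribs mult_ac)
  also have "\<dots> \<le> 2 ^ card F * exp (s1 * S) * (2 * exp (s1 * d + s1 * (1 + 2 * s1 * d) * y\<^sup>2))"
    using s1 unfolding d_def by (intro mult_left_mono sum_exp_square_sign) auto
  also have "\<dots> = 2 ^ card (insert q F) * exp (s1 * S + s1 * d + s1 * (1 + 2 * s1 * d) * y\<^sup>2)"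
    by (simp only: exp_add card_insert_disjoint[OF insert.hyps] power_Suc mult_ac)
  also have "\<dots> \<le> 2 ^ card (insert q F) * exp (s2 * S + s2 * d + s2 * y\<^sup>2)"
    using s2 s12 S0 d0 by (intro mult_left_mono iffD2[OF exp_le_cancel_iff] add_mono mult_right_mono) auto
  also have "\<dots> = 2 ^ card (insert q F) * exp (s2 * (y\<^sup>2 + (d + S)))"
    by (simp add: algebra_simps)
  finally show ?case unfolding sum_insert s2_def .
qed

lemma rademacher_square_mgf:
  fixes c :: "'i \<Rightarrow> real"
  assumes "finite I" "(\<Sum>p\<in>I. (c p)\<^sup>2) \<le> 1"
  shows "(\<Sum>\<sigma>\<in>signs I. exp ((\<Sum>p\<in>I. c p * \<sigma> p)\<^sup>2 / 4)) \<le> 2 ^ card I * exp (1 / 2)"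
proof -
  define S where "S = (\<Sum>p\<in>I. (c p)\<^sup>2)"
  have S: "0 \<le> S" "S \<le> 1" using assms by (auto simp: S_def sum_nonneg)
  have "(\<Sum>\<sigma>\<in>signs I. exp ((\<Sum>p\<in>I. c p * \<sigma> p)\<^sup>2 / 4)) \<le>
      2 ^ card I * exp ((1/4) / (1 - 2 * (1/4) * S) * (0\<^sup>2 + S))"
    using rademacher_square_mgf_shifted[of I "1/4" c 0] assms S unfolding S_def[symmetric] by simp
  also have "(1/4) / (1 - 2 * (1/4) * S) * (0\<^sup>2 + S) \<le> 1/2"
    using S by (simp add: field_simps)
  finally show ?thesis by simp
qed

text \<open>The square of the modulus is the sum of the squares of two real sign sums, and
\<open>exp ((u + v) / 8) \<le> (exp (u / 4) + exp (v / 4)) / 2\<close> separates them.\<close>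
lemma rademacher_square_mgf_complex:
  fixes c :: "'i \<Rightarrow> complex"
  assumes "finite I" "(\<Sum>p\<in>I. (cmod (c p))\<^sup>2) \<le> 1"
  shows "(\<Sum>\<sigma>\<in>signs I. exp ((cmod (\<Sum>p\<in>I. c p * of_real (\<sigma> p)))\<^sup>2 / 8)) \<le> 2 ^ card I * exp (1 / 2)"
proof -
  define R where "R \<sigma> = (\<Sum>p\<in>I. Re (c p) * \<sigma> p)" for \<sigma>
  define J where "J \<sigma> = (\<Sum>p\<in>I. Im (c p) * \<sigma> p)" for \<sigma>
  have norm: "(cmod (\<Sum>p\<in>I. c p * of_real (\<sigma> p)))\<^sup>2 = (R \<sigma>)\<^sup>2 + (J \<sigma>)\<^sup>2" for \<sigma>
    by (simp add: cmod_power2 R_def J_def)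
  have mean: "exp ((u + v) / 8) \<le> (exp (u / 4) + exp (v / 4)) / 2" for u v :: real
  proof -
    have "0 \<le> (exp (u / 8) - exp (v / 8))\<^sup>2" by simp
    then show ?thesis
      by (simp add: power2_eq_square algebra_simps add_divide_distrib exp_add[symmetric])
  qed
  have le: "(\<Sum>p\<in>I. (Re (c p))\<^sup>2) \<le> 1" "(\<Sum>p\<in>I. (Im (c p))\<^sup>2) \<le> 1"
    using assms(2) sum_nonneg[of I "\<lambda>p. (Re (c p))\<^sup>2"] sum_nonneg[of I "\<lambda>p. (Im (c p))\<^sup>2"]
    by (simp_all add: cmod_power2 sum.distrib)
  have "(\<Sum>\<sigma>\<in>signs I. exp ((cmod (\<Sum>p\<in>I. c p * of_real (\<sigma> p)))\<^sup>2 / 8)) \<le>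
      (\<Sum>\<sigma>\<in>signs I. (exp ((R \<sigma>)\<^sup>2 / 4) + exp ((J \<sigma>)\<^sup>2 / 4)) / 2)"
    unfolding norm by (intro sum_mono mean)
  also have "\<dots> = ((\<Sum>\<sigma>\<in>signs I. exp ((R \<sigma>)\<^sup>2 / 4)) + (\<Sum>\<sigma>\<in>signs I. exp ((J \<sigma>)\<^sup>2 / 4))) / 2"
    by (simp only: sum.distrib sum_divide_distrib[symmetric])
  also have "\<dots> \<le> 2 ^ card I * exp (1 / 2)"
    using rademacher_square_mgf[OF assms(1) le(1)] rademacher_square_mgf[OF assms(1) le(2)]
    by (simp add: R_def J_def)
  finally show ?thesis .
qed

lemma rademacher_tail:
  fixes c :: "'i \<Rightarrow> real"
  assumes "finite I" "(\<Sum>p\<in>I. (c p)\<^sup>2) \<le> 1" "0 \<le> t"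
  shows "real (card {\<sigma> \<in> signs I. t \<le> (\<Sum>p\<in>I. c p * \<sigma> p)}) \<le> 2 ^ card I * exp (1 / 2 - t\<^sup>2 / 4)"
proof -
  define B where "B = {\<sigma> \<in> signs I. t \<le> (\<Sum>p\<in>I. c p * \<sigma> p)}"
  have "real (card B) * exp (t\<^sup>2 / 4) = (\<Sum>\<sigma>\<in>B. exp (t\<^sup>2 / 4))" by simp
  also have "\<dots> \<le> (\<Sum>\<sigma>\<in>B. exp ((\<Sum>p\<in>I. c p * \<sigma> p)\<^sup>2 / 4))"
    using assms(3) by (intro sum_mono) (auto simp: B_def intro!: power_mono)
  also have "\<dots> \<le> (\<Sum>\<sigma>\<in>signs I. exp ((\<Sum>p\<in>I. c p * \<sigma> p)\<^sup>2 / 4))"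
    using assms(1) by (intro sum_mono2) (auto simp: B_def)
  also have "\<dots> \<le> 2 ^ card I * exp (1 / 2)"
    using assms by (intro rademacher_square_mgf)
  finally show ?thesis
    by (simp only: B_def exp_diff times_divide_eq_right pos_le_divide_eq[OF exp_gt_zero])
qed

section \<open>Most sign matrices have operator norm of order square root of the size\<close>

definition bilin :: "'i set \<Rightarrow> ('i \<times> 'i \<Rightarrow> real) \<Rightarrow> ('i \<Rightarrow> real) \<Rightarrow> ('i \<Rightarrow> real) \<Rightarrow> real" where
  "bilin J \<sigma> x y = (\<Sum>i\<in>J. \<Sum>j\<in>J. \<sigma> (i, j) * x i * y j)"

lemma bilin_scale: "bilin J \<sigma> (\<lambda>i. a * x i) (\<lambda>j. b * y j) = a * b * bilin J \<sigma> x y"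
  unfolding bilin_def by (simp add: sum_distrib_left mult_ac)

lemma bilin_diff_left: "bilin J \<sigma> (\<lambda>i. x i - x' i) y = bilin J \<sigma> x y - bilin J \<sigma> x' y"
  unfolding bilin_def by (simp add: sum_subtractf[symmetric] algebra_simps)

lemma bilin_diff_right: "bilin J \<sigma> x (\<lambda>i. y i - y' i) = bilin J \<sigma> x y - bilin J \<sigma> x y'"
  unfolding bilin_def by (simp add: sum_subtractf[symmetric] algebra_simps)

text \<open>The integer points of the Euclidean ball of radius \<open>4 \<surd>m\<close>, where \<open>m\<close> is the number of coordinates.
Divided by \<open>4 \<surd>m\<close> they form a net for the unit ball. The box of side \<open>8m\<close> contains this ball and places
the set inside a finite product, where weights factorize.\<close>
definition lattice_ball :: "'i set \<Rightarrow> ('i \<Rightarrow> int) set" where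
  "lattice_ball J = {z \<in> PiE J (\<lambda>_. {- 4 * int (card J)..4 * int (card J)}).
     (\<Sum>i\<in>J. (z i)\<^sup>2) \<le> 16 * int (card J)}"

lemma finite_lattice_ball [simp]: "finite J \<Longrightarrow> finite (lattice_ball J)"
  by (simp add: lattice_ball_def finite_PiE)

lemma sum_half_powers: "(\<Sum>k\<in>{- int L..int L}. (1/2 :: real) ^ nat \<bar>k\<bar>) = 3 - 2 * (1/2) ^ L"
proof (induction L)
  case (Suc L)
  have "{- int (Suc L)..int (Suc L)} = insert (- int (Suc L)) (insert (int (Suc L)) {- int L..int L})"
    by auto
  moreover have "- int (Suc L) \<notin> insert (int (Suc L)) {- int L..int L}" "int (Suc L) \<notin> {- int L..int L}"
    by auto
  ultimately have "(\<Sum>k\<in>{- int (Suc L)..int (Suc L)}. (1/2 :: real) ^ nat \<bar>k\<bar>) =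
      (1/2) ^ nat \<bar>- int (Suc L)\<bar> + ((1/2) ^ nat \<bar>int (Suc L)\<bar> + (\<Sum>k\<in>{- int L..int L}. (1/2) ^ nat \<bar>k\<bar>))"
    by (simp only: sum.insert finite_insert finite_atLeastAtMost_int not_False_eq_True simp_thms)
  also have "\<dots> = 3 - 2 * (1/2) ^ Suc L"
    unfolding Suc by (simp only: abs_minus_cancel abs_of_nat nat_int power_Suc)
  finally show ?case .
qed simp

text \<open>Give \<open>z\<close> the weight \<open>\<Prod>i. (1/2) ^ |z\<^sub>i|\<close>. On the lattice ball every weight is at least \<open>(1/2) ^ (16 m)\<close> because \<open>|z\<^sub>i| \<le> z\<^sub>i\<^sup>2\<close>, while
the total weight of the lattice is a product of \<open>m\<close> geometric sums, each at most \<open>3\<close>.\<close>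
lemma card_lattice_ball:
  assumes "finite J"
  shows "real (card (lattice_ball J)) \<le> 2 ^ (18 * card J)"
proof -
  define m where "m = card J"
  have low: "(1/2::real) ^ (16 * m) \<le> (\<Prod>i\<in>J. (1/2) ^ nat \<bar>z i\<bar>)" if "z \<in> lattice_ball J" for z
  proof -
    have "int (\<Sum>i\<in>J. nat \<bar>z i\<bar>) = (\<Sum>i\<in>J. \<bar>z i\<bar>)" by simp
    also have "\<dots> \<le> (\<Sum>i\<in>J. (z i)\<^sup>2)"
    proof (rule sum_mono)
      fix i
      show "\<bar>z i\<bar> \<le> (z i)\<^sup>2"
        using mult_left_mono[of 1 "\<bar>z i\<bar>" "\<bar>z i\<bar>"] by (cases "z i = 0") (auto simp: power2_eq_square)
    qed
    also have "\<dots> \<le> int (16 * m)" using that by (simp add: lattice_ball_def m_def)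
    finally have "(\<Sum>i\<in>J. nat \<bar>z i\<bar>) \<le> 16 * m" by (simp only: of_nat_le_iff)
    then have "(1/2::real) ^ (16 * m) \<le> (1/2) ^ (\<Sum>i\<in>J. nat \<bar>z i\<bar>)"
      by (intro power_decreasing) auto
    then show ?thesis by (simp add: power_sum)
  qed
  have "real (card (lattice_ball J)) * (1/2) ^ (16 * m) = (\<Sum>z\<in>lattice_ball J. (1/2) ^ (16 * m))"
    by simp
  also have "\<dots> \<le> (\<Sum>z\<in>lattice_ball J. \<Prod>i\<in>J. (1/2) ^ nat \<bar>z i\<bar>)"
    by (intro sum_mono low)
  also have "\<dots> \<le> (\<Sum>z\<in>PiE J (\<lambda>_. {- int (4 * m)..int (4 * m)}). \<Prod>i\<in>J. (1/2) ^ nat \<bar>z i\<bar>)"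
    using assms by (intro sum_mono2 finite_PiE) (auto simp: lattice_ball_def m_def intro!: prod_nonneg)
  also have "\<dots> = (\<Prod>i\<in>J. \<Sum>k\<in>{- int (4 * m)..int (4 * m)}. (1/2) ^ nat \<bar>k\<bar>)"
    using assms by (subst prod_sum_PiE) auto
  also have "\<dots> = (3 - 2 * (1/2) ^ (4 * m)) ^ m"
    unfolding sum_half_powers by (simp add: m_def)
  also have "\<dots> \<le> 4 ^ m"
    using power_le_one[of "1/2 :: real" "4 * m"] zero_le_power[of "1/2 :: real" "4 * m"]
    by (intro power_mono) linarith+
  finally have "real (card (lattice_ball J)) \<le> 4 ^ m * 2 ^ (16 * m)"
    by (simp add: power_divide field_simps)
  also have "\<dots> = 2 ^ (18 * m)"
    by (simp add: power_mult flip: power_mult_distrib)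
  finally show ?thesis by (simp add: m_def)
qed

lemma rounding_towards_zero: "\<exists>z::int. \<bar>real_of_int z\<bar> \<le> \<bar>u\<bar> \<and> \<bar>u - real_of_int z\<bar> \<le> 1"
proof (cases "0 \<le> u")
  case True
  then have "0 \<le> \<lfloor>u\<rfloor>" by simp
  then show ?thesis using True by (intro exI[of _ "\<lfloor>u\<rfloor>"] conjI) linarith+
next
  case False
  then have "\<lceil>u\<rceil> \<le> 0" by simp
  then show ?thesis using False by (intro exI[of _ "\<lceil>u\<rceil>"] conjI) linarith+
qed

text \<open>Round \<open>4 \<surd>m x\<^sub>i\<close> to an integer. Rounding towards zero does not increase the norm, and the \<open>m\<close>
coordinate errors of at most \<open>1 / (4 \<surd>m)\<close> add up to a squared error of at most \<open>1/16\<close>.\<close>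
lemma lattice_ball_approx:
  fixes x :: "'i \<Rightarrow> real"
  assumes J: "finite J" "J \<noteq> {}" and x: "(\<Sum>i\<in>J. (x i)\<^sup>2) \<le> 1"
  shows "\<exists>z\<in>lattice_ball J. (\<Sum>i\<in>J. (x i - real_of_int (z i) / (4 * sqrt (card J)))\<^sup>2) \<le> 1 / 16"
proof -
  define m where "m = card J"
  define r where "r = 4 * sqrt m"
  have m: "1 \<le> m" using J by (simp add: m_def Suc_le_eq card_gt_0_iff)
  have r: "0 < r" "r\<^sup>2 = 16 * m" using m by (auto simp: r_def power_mult_distrib)
  have r4: "r \<le> 4 * m" using m by (simp add: r_def real_le_lsqrt power2_eq_square)
  have "\<forall>i. \<exists>z::int. \<bar>real_of_int z\<bar> \<le> \<bar>r * x i\<bar> \<and> \<bar>r * x i - real_of_int z\<bar> \<le> 1"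
    using rounding_towards_zero by blast
  then obtain z0 :: "'i \<Rightarrow> int" where z0:
    "\<And>i. \<bar>real_of_int (z0 i)\<bar> \<le> \<bar>r * x i\<bar>" "\<And>i. \<bar>r * x i - real_of_int (z0 i)\<bar> \<le> 1"
    by metis
  define z where "z = restrict z0 J"
  have zi: "z i = z0 i" if "i \<in> J" for i using that by (simp add: z_def)
  have "(\<Sum>i\<in>J. (real_of_int (z i))\<^sup>2) \<le> (\<Sum>i\<in>J. (r * x i)\<^sup>2)"
    using z0(1) by (intro sum_mono) (simp add: zi abs_le_square_iff)
  also have "\<dots> = r\<^sup>2 * (\<Sum>i\<in>J. (x i)\<^sup>2)" by (simp add: sum_distrib_left power_mult_distrib)
  also have "\<dots> \<le> r\<^sup>2 * 1" using x by (intro mult_left_mono) auto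
  finally have "real_of_int (\<Sum>i\<in>J. (z i)\<^sup>2) \<le> real_of_int (16 * int m)" using r by simp
  then have sq: "(\<Sum>i\<in>J. (z i)\<^sup>2) \<le> 16 * int m" by (simp only: of_int_le_iff)
  have "z i \<in> {- 4 * int m..4 * int m}" if i: "i \<in> J" for i
  proof -
    have "(x i)\<^sup>2 \<le> (\<Sum>i\<in>J. (x i)\<^sup>2)" using J(1) i by (intro member_le_sum) auto
    then have "\<bar>x i\<bar> \<le> 1" using x by (simp add: abs_square_le_1[symmetric])
    then have "\<bar>r * x i\<bar> \<le> r * 1" using r(1) by (simp only: abs_mult) (intro mult_mono; simp)
    then have "\<bar>real_of_int (z i)\<bar> \<le> 4 * m" using z0(1)[of i] r4 zi[OF i] by linarith
    then show ?thesis by simp linarith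
  qed
  then have mem: "z \<in> lattice_ball J"
    using sq by (auto simp: lattice_ball_def m_def[symmetric] z_def)
  have "(\<Sum>i\<in>J. (x i - real_of_int (z i) / r)\<^sup>2) \<le> (\<Sum>i\<in>J. 1 / r\<^sup>2)"
  proof (rule sum_mono)
    fix i assume i: "i \<in> J"
    have "\<bar>x i - real_of_int (z i) / r\<bar> = \<bar>r * x i - real_of_int (z i)\<bar> / r"
      using r(1) by (subst abs_of_pos[OF r(1), symmetric], subst abs_divide[symmetric]) (simp add: field_simps)
    also have "\<dots> \<le> 1 / r" using z0(2)[of i] r(1) zi[OF i] by (simp add: divide_right_mono)
    finally have "\<bar>x i - real_of_int (z i) / r\<bar>\<^sup>2 \<le> (1 / r)\<^sup>2"
      by (intro power_mono) auto
    then show "(x i - real_of_int (z i) / r)\<^sup>2 \<le> 1 / r\<^sup>2"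
      by (simp add: power_one_over)
  qed
  also have "\<dots> = 1 / 16" using r m by (simp add: m_def[symmetric])
  finally show ?thesis using mem unfolding r_def m_def by blast
qed

text \<open>Replacing \<open>x\<close> and \<open>y\<close> in turn by net points at distance at most \<open>1/4\<close> costs a quarter of the supremum
\<open>L\<close> of the form each time, so \<open>L \<le> T + L/2\<close>.\<close>
lemma bilin_le_of_lattice_ball:
  fixes T :: real
  assumes J: "finite J" "J \<noteq> {}"
    and net: "\<And>z w. z \<in> lattice_ball J \<Longrightarrow> w \<in> lattice_ball J \<Longrightarrow>
      bilin J \<sigma> (\<lambda>i. real_of_int (z i)) (\<lambda>j. real_of_int (w j)) \<le> 16 * card J * T"
    and x: "(\<Sum>i\<in>J. (x i)\<^sup>2) \<le> 1" and y: "(\<Sum>i\<in>J. (y i)\<^sup>2) \<le> 1"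
  shows "bilin J \<sigma> x y \<le> 2 * T"
proof -
  define U where "U = {x. (\<Sum>i\<in>J. (x i)\<^sup>2) \<le> (1::real)}"
  define L where "L = (SUP (x, y)\<in>U \<times> U. bilin J \<sigma> x y)"
  have m: "1 \<le> card J" using J by (simp add: Suc_le_eq card_gt_0_iff)
  have bound: "bilin J \<sigma> x y \<le> (\<Sum>i\<in>J. \<Sum>j\<in>J. \<bar>\<sigma> (i, j)\<bar>)" if "x \<in> U" "y \<in> U" for x y
    unfolding bilin_def
  proof (intro sum_mono)
    fix i j assume ij: "i \<in> J" "j \<in> J"
    have "(x i)\<^sup>2 \<le> (\<Sum>i\<in>J. (x i)\<^sup>2)" "(y j)\<^sup>2 \<le> (\<Sum>i\<in>J. (y i)\<^sup>2)"
      using J(1) ij by (intro member_le_sum; simp)+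
    then have "\<bar>x i\<bar> \<le> 1" "\<bar>y j\<bar> \<le> 1" using that by (auto simp: U_def abs_square_le_1[symmetric])
    then have "\<bar>\<sigma> (i, j)\<bar> * \<bar>x i\<bar> * \<bar>y j\<bar> \<le> \<bar>\<sigma> (i, j)\<bar> * 1 * 1"
      by (intro mult_mono) auto
    then show "\<sigma> (i, j) * x i * y j \<le> \<bar>\<sigma> (i, j)\<bar>"
      by (simp add: abs_mult[symmetric])
  qed
  have le_L: "bilin J \<sigma> x y \<le> L" if "x \<in> U" "y \<in> U" for x y
    unfolding L_def using that bound
    by (intro cSUP_upper2[where x = "(x, y)"] bdd_aboveI2[where M = "\<Sum>i\<in>J. \<Sum>j\<in>J. \<bar>\<sigma> (i, j)\<bar>"]) auto
  have step: "bilin J \<sigma> x y \<le> T + L / 2" if xy: "x \<in> U" "y \<in> U" for x y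
  proof -
    define r where "r = 4 * sqrt (card J)"
    have r: "0 < r" "r * r = 16 * card J" using m by (auto simp: r_def)
    obtain z where z: "z \<in> lattice_ball J" "(\<Sum>i\<in>J. (x i - real_of_int (z i) / r)\<^sup>2) \<le> 1 / 16"
      using lattice_ball_approx[OF J] xy unfolding U_def r_def by blast
    obtain w where w: "w \<in> lattice_ball J" "(\<Sum>i\<in>J. (y i - real_of_int (w i) / r)\<^sup>2) \<le> 1 / 16"
      using lattice_ball_approx[OF J] xy unfolding U_def r_def by blast
    define x' where "x' i = real_of_int (z i) / r" for i
    define y' where "y' i = real_of_int (w i) / r" for i
    have four: "(\<lambda>i. 4 * (x i - x' i)) \<in> U" "(\<lambda>i. 4 * (y i - y' i)) \<in> U"
    proof -
      have sixteen: "(\<Sum>i\<in>J. (4 * f i)\<^sup>2) = 16 * (\<Sum>i\<in>J. (f i)\<^sup>2)" for f :: "'a \<Rightarrow> real"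
        by (simp add: power_mult_distrib sum_distrib_left)
      then show "(\<lambda>i. 4 * (x i - x' i)) \<in> U" "(\<lambda>i. 4 * (y i - y' i)) \<in> U"
        using z(2) w(2) unfolding U_def x'_def y'_def mem_Collect_eq sixteen by linarith+
    qed
    have x'U: "x' \<in> U"
    proof -
      have "(\<Sum>i\<in>J. (x' i)\<^sup>2) = real_of_int (\<Sum>i\<in>J. (z i)\<^sup>2) / r\<^sup>2"
        by (simp add: x'_def power_divide sum_divide_distrib)
      also have "\<dots> \<le> real_of_int (16 * int (card J)) / r\<^sup>2"
        using z(1) by (intro divide_right_mono) (simp_all only: of_int_le_iff lattice_ball_def, auto)
      also have "\<dots> = 1" using r m by (simp add: power2_eq_square)
      finally show ?thesis by (simp add: U_def)
    qed
    have "bilin J \<sigma> x' y' = bilin J \<sigma> (\<lambda>i. (1 / r) * real_of_int (z i)) (\<lambda>i. (1 / r) * real_of_int (w i))"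
      by (simp add: x'_def[abs_def] y'_def[abs_def])
    also have "\<dots> = bilin J \<sigma> (\<lambda>i. real_of_int (z i)) (\<lambda>i. real_of_int (w i)) / (r * r)"
      unfolding bilin_scale by simp
    also have "\<dots> \<le> (16 * card J * T) / (r * r)"
      using r by (intro divide_right_mono net z w) auto
    also have "\<dots> = T" using r m by simp
    finally have 1: "bilin J \<sigma> x' y' \<le> T" .
    have 2: "4 * bilin J \<sigma> (\<lambda>i. x i - x' i) y \<le> L"
      using le_L[OF four(1) xy(2)] bilin_scale[of J \<sigma> 4 "\<lambda>i. x i - x' i" 1 y] by simp
    have 3: "4 * bilin J \<sigma> x' (\<lambda>i. y i - y' i) \<le> L"
      using le_L[OF x'U four(2)] bilin_scale[of J \<sigma> 1 x' 4 "\<lambda>i. y i - y' i"] by simp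
    show ?thesis using 1 2 3 unfolding bilin_diff_left bilin_diff_right by simp
  qed
  have "(\<lambda>_. 0) \<in> U" by (simp add: U_def)
  then have "L \<le> T + L / 2" unfolding L_def[symmetric]
    using step by (subst L_def, intro cSUP_least) auto
  then show ?thesis using le_L[of x y] x y by (simp add: U_def)
qed

text \<open>The sign matrices of operator norm at most \<open>28 \<surd>m\<close>, the norm being expressed through the bilinear form.\<close>
definition bounded_signs :: "'i set \<Rightarrow> ('i \<times> 'i \<Rightarrow> real) set" where
  "bounded_signs J = {\<sigma> \<in> signs (J \<times> J). \<forall>x y. (\<Sum>i\<in>J. (x i)\<^sup>2) \<le> 1 \<longrightarrow> (\<Sum>i\<in>J. (y i)\<^sup>2) \<le> 1 \<longrightarrow>
     bilin J \<sigma> x y \<le> 28 * sqrt (card J)}"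

text \<open>Union bound: a sign matrix that is not bounded reaches the value \<open>T = 14 \<surd>m\<close> at some pair of net points. There
are at most \<open>2 ^ (36 m)\<close> pairs, and each contributes a proportion of at most \<open>exp (1/2 - T\<^sup>2/4) = exp (1/2 - 49m)\<close>.\<close>
lemma card_bounded_signs:
  assumes J: "finite J" "J \<noteq> {}"
  shows "2 / 3 * 2 ^ card (J \<times> J) \<le> real (card (bounded_signs J))"
proof -
  define m where "m = card J"
  define N where "N = lattice_ball J"
  define T where "T = 14 * sqrt m"
  define c where "c z w = (\<lambda>(i, j). real_of_int (z i) * real_of_int (w j) / (16 * m))" for z w :: "'a \<Rightarrow> int"
  define bad where "bad z w = {\<sigma> \<in> signs (J \<times> J). T \<le> (\<Sum>p\<in>J \<times> J. c z w p * \<sigma> p)}" for z w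
  have m: "1 \<le> m" using J by (simp add: m_def Suc_le_eq card_gt_0_iff)
  have finN: "finite N" using J by (simp add: N_def)
  have c: "(\<Sum>p\<in>J \<times> J. c z w p * \<sigma> p) = bilin J \<sigma> (\<lambda>i. real_of_int (z i)) (\<lambda>j. real_of_int (w j)) / (16 * m)"
    for z w \<sigma>
    unfolding bilin_def c_def by (simp add: sum.cartesian_product sum_divide_distrib case_prod_unfold mult_ac)
  have "signs (J \<times> J) - bounded_signs J \<subseteq> (\<Union>(z, w)\<in>N \<times> N. bad z w)"
  proof
    fix \<sigma> assume \<sigma>: "\<sigma> \<in> signs (J \<times> J) - bounded_signs J"
    show "\<sigma> \<in> (\<Union>(z, w)\<in>N \<times> N. bad z w)"
    proof (rule ccontr)
      assume not_bad: "\<sigma> \<notin> (\<Union>(z, w)\<in>N \<times> N. bad z w)"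
      have net: "bilin J \<sigma> (\<lambda>i. real_of_int (z i)) (\<lambda>j. real_of_int (w j)) \<le> 16 * card J * T"
        if "z \<in> lattice_ball J" "w \<in> lattice_ball J" for z w
      proof -
        have "\<sigma> \<notin> bad z w" using that not_bad by (auto simp: N_def)
        then have "(\<Sum>p\<in>J \<times> J. c z w p * \<sigma> p) < T" using \<sigma> by (auto simp: bad_def)
        moreover have "0 < real (16 * m)" using m by simp
        ultimately have "bilin J \<sigma> (\<lambda>i. real_of_int (z i)) (\<lambda>j. real_of_int (w j)) < T * real (16 * m)"
          unfolding c by (simp only: pos_divide_less_eq)
        then show ?thesis by (simp add: m_def mult_ac)
      qed
      have "bilin J \<sigma> x y \<le> 28 * sqrt (card J)"
        if "(\<Sum>i\<in>J. (x i)\<^sup>2) \<le> 1" "(\<Sum>i\<in>J. (y i)\<^sup>2) \<le> 1" for x y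
      proof -
        have "bilin J \<sigma> x y \<le> 2 * T"
          by (rule bilin_le_of_lattice_ball[OF J]) (fact net that)+
        then show ?thesis by (simp add: T_def m_def)
      qed
      then show False using \<sigma> by (simp add: bounded_signs_def)
    qed
  qed
  then have "card (signs (J \<times> J) - bounded_signs J) \<le> card (\<Union>(z, w)\<in>N \<times> N. bad z w)"
    using J finN by (intro card_mono finite_UN_I) (auto simp: bad_def)
  also have "\<dots> \<le> (\<Sum>(z, w)\<in>N \<times> N. card (bad z w))"
    using card_UN_le[of "N \<times> N" "\<lambda>(z, w). bad z w"] finN by (simp add: case_prod_unfold)
  finally have "real (card (signs (J \<times> J) - bounded_signs J)) \<le> real (\<Sum>(z, w)\<in>N \<times> N. card (bad z w))"
    by (rule of_nat_mono)
  also have "\<dots> = (\<Sum>(z, w)\<in>N \<times> N. real (card (bad z w)))"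
    by (simp only: of_nat_sum case_prod_unfold)
  also have "\<dots> \<le> (\<Sum>(z, w)\<in>N \<times> N. 2 ^ card (J \<times> J) * exp (1 / 2 - T\<^sup>2 / 4))"
  proof (rule sum_mono, clarify)
    fix z w assume zw: "z \<in> N" "w \<in> N"
    have "(\<Sum>p\<in>J \<times> J. (c z w p)\<^sup>2) = (\<Sum>i\<in>J. \<Sum>j\<in>J. (z i)\<^sup>2 * (w j)\<^sup>2 / (16 * m)\<^sup>2)"
      by (simp add: sum.cartesian_product c_def case_prod_unfold power_mult_distrib power_divide)
    also have "\<dots> = real_of_int ((\<Sum>i\<in>J. (z i)\<^sup>2) * (\<Sum>j\<in>J. (w j)\<^sup>2)) / (16 * m)\<^sup>2"
      by (simp add: sum_product sum_divide_distrib)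
    also have "\<dots> \<le> real_of_int ((16 * int m) * (16 * int m)) / (16 * m)\<^sup>2"
      using zw by (intro divide_right_mono, subst of_int_le_iff, intro mult_mono)
        (auto simp: N_def lattice_ball_def m_def intro: sum_nonneg)
    also have "\<dots> = 1" using m by (simp add: power2_eq_square)
    finally show "real (card (bad z w)) \<le> 2 ^ card (J \<times> J) * exp (1 / 2 - T\<^sup>2 / 4)"
      unfolding bad_def using J by (intro rademacher_tail) (auto simp: T_def)
  qed
  also have "\<dots> = 2 ^ card (J \<times> J) * ((real (card N))\<^sup>2 * exp (1 / 2 - T\<^sup>2 / 4))"
    by (simp add: case_prod_unfold card_cartesian_product power2_eq_square)
  also have "\<dots> \<le> 2 ^ card (J \<times> J) * (1 / 3)"
  proof (rule mult_left_mono)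
    have "(real (card N))\<^sup>2 \<le> (2 ^ (18 * m))\<^sup>2"
      using card_lattice_ball[OF J(1)] by (intro power_mono) (auto simp: N_def m_def)
    also have "\<dots> = 2 ^ (36 * m)" by (simp flip: power_mult)
    also have "\<dots> \<le> exp 1 ^ (36 * m)" using exp_ge_add_one_self[of 1] by (intro power_mono) auto
    also have "\<dots> = exp (36 * m)" by (simp flip: exp_of_nat_mult)
    finally have "(real (card N))\<^sup>2 * exp (1 / 2 - T\<^sup>2 / 4) \<le> exp (36 * m) * exp (1 / 2 - T\<^sup>2 / 4)"
      by (intro mult_right_mono) auto
    also have "\<dots> = exp (1 / 2 - 13 * m)"
      by (simp add: T_def power_mult_distrib mult_exp_exp)
    also have "\<dots> \<le> exp (- 2)" using m by simp
    also have "\<dots> \<le> 1 / 3" using exp_ge_add_one_self[of 2] by (simp add: exp_minus field_simps)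
    finally show "(real (card N))\<^sup>2 * exp (1 / 2 - T\<^sup>2 / 4) \<le> 1 / 3" .
  qed simp
  finally have "real (card (signs (J \<times> J) - bounded_signs J)) \<le> 2 ^ card (J \<times> J) * (1 / 3)" .
  moreover have "card (signs (J \<times> J) - bounded_signs J) = card (signs (J \<times> J)) - card (bounded_signs J)"
    "card (bounded_signs J) \<le> card (signs (J \<times> J))"
    using J by (auto simp: bounded_signs_def intro!: card_Diff_subset card_mono intro: finite_subset[of _ "signs (J \<times> J)"])
  ultimately show ?thesis using J by (simp add: card_signs of_nat_diff)
qed

lemma bounded_signsD:
  "\<sigma> \<in> bounded_signs J \<Longrightarrow> (\<Sum>i\<in>J. (x i)\<^sup>2) \<le> 1 \<Longrightarrow> (\<Sum>i\<in>J. (y i)\<^sup>2) \<le> 1 \<Longrightarrow>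
    bilin J \<sigma> x y \<le> 28 * sqrt (card J)"
  by (simp add: bounded_signs_def)

text \<open>The bound on the form, applied to \<open>x = \<sigma>y / |\<sigma>y|\<close>, becomes a bound on \<open>|\<sigma>y|\<close>; here \<open>784 = 28\<^sup>2\<close>.\<close>
lemma bounded_signs_apply:
  fixes y :: "'i \<Rightarrow> real"
  assumes J: "finite J" and \<sigma>: "\<sigma> \<in> bounded_signs J"
  shows "(\<Sum>i\<in>J. (\<Sum>j\<in>J. \<sigma> (i, j) * y j)\<^sup>2) \<le> 784 * card J * (\<Sum>j\<in>J. (y j)\<^sup>2)"
proof -
  define w where "w i = (\<Sum>j\<in>J. \<sigma> (i, j) * y j)" for i
  define a where "a = sqrt (\<Sum>j\<in>J. (y j)\<^sup>2)"
  define b where "b = sqrt (\<Sum>i\<in>J. (w i)\<^sup>2)"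
  have a2: "a\<^sup>2 = (\<Sum>j\<in>J. (y j)\<^sup>2)" and b2: "b\<^sup>2 = (\<Sum>i\<in>J. (w i)\<^sup>2)"
    by (simp_all add: a_def b_def sum_nonneg)
  have nonneg: "0 \<le> a" "0 \<le> b" by (simp_all add: a_def b_def sum_nonneg)
  have "b \<le> 28 * sqrt (card J) * a"
  proof (cases "a = 0 \<or> b = 0")
    case True
    then show ?thesis
    proof
      assume "a = 0"
      then have "\<forall>j\<in>J. y j = 0" using a2 J by (simp add: sum_nonneg_eq_0_iff)
      then show ?thesis by (simp add: b_def w_def nonneg)
    qed (use nonneg in simp)
  next
    case False
    have unit: "(\<Sum>i\<in>J. ((1 / b) * w i)\<^sup>2) \<le> 1" "(\<Sum>j\<in>J. ((1 / a) * y j)\<^sup>2) \<le> 1"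
      using False by (simp_all add: power_divide sum_divide_distrib[symmetric] a2[symmetric] b2[symmetric])
    have "bilin J \<sigma> w y = (\<Sum>i\<in>J. w i * (\<Sum>j\<in>J. \<sigma> (i, j) * y j))"
      by (simp add: bilin_def sum_distrib_left mult_ac)
    also have "\<dots> = b\<^sup>2"
      unfolding b2 by (simp add: w_def[symmetric] power2_eq_square)
    finally have "bilin J \<sigma> w y = b\<^sup>2" .
    then have "(1 / b) * (1 / a) * b\<^sup>2 = bilin J \<sigma> (\<lambda>i. (1 / b) * w i) (\<lambda>j. (1 / a) * y j)"
      by (simp only: bilin_scale)
    also have "\<dots> \<le> 28 * sqrt (card J)" by (rule bounded_signsD[OF \<sigma> unit])
    finally show ?thesis using False nonneg by (simp add: power2_eq_square field_simps)
  qed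
  then have "b\<^sup>2 \<le> (28 * sqrt (card J) * a)\<^sup>2" using nonneg by (intro power_mono) auto
  then show ?thesis by (simp add: power_mult_distrib a2[symmetric] b2 w_def)
qed

section \<open>Orthogonality of the entries under sign changes\<close>

definition flip_row :: "'i set \<Rightarrow> 'i \<Rightarrow> ('i \<times> 'i \<Rightarrow> real) \<Rightarrow> 'i \<times> 'i \<Rightarrow> real" where
  "flip_row J a \<sigma> = (\<lambda>p\<in>J \<times> J. if fst p = a then - \<sigma> p else \<sigma> p)"

definition flip_col :: "'i set \<Rightarrow> 'i \<Rightarrow> ('i \<times> 'i \<Rightarrow> real) \<Rightarrow> 'i \<times> 'i \<Rightarrow> real" where
  "flip_col J a \<sigma> = (\<lambda>p\<in>J \<times> J. if snd p = a then - \<sigma> p else \<sigma> p)"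

lemma flip_row_bounded_signs:
  assumes \<sigma>: "\<sigma> \<in> bounded_signs J"
  shows "flip_row J a \<sigma> \<in> bounded_signs J"
proof -
  have "flip_row J a \<sigma> \<in> signs (J \<times> J)"
    using \<sigma> by (fastforce simp: bounded_signs_def signs_def flip_row_def PiE_iff)
  moreover have "bilin J (flip_row J a \<sigma>) x y = bilin J \<sigma> (\<lambda>i. if i = a then - x i else x i) y" for x y
    unfolding bilin_def by (intro sum.cong) (auto simp: flip_row_def)
  moreover have "(\<Sum>i\<in>J. (if i = a then - x i else x i)\<^sup>2) = (\<Sum>i\<in>J. (x i)\<^sup>2)" for x :: "_ \<Rightarrow> real"
    by (intro sum.cong) auto
  ultimately show ?thesis using \<sigma> by (simp add: bounded_signs_def)
qed

lemma flip_col_bounded_signs: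
  assumes \<sigma>: "\<sigma> \<in> bounded_signs J"
  shows "flip_col J a \<sigma> \<in> bounded_signs J"
proof -
  have "flip_col J a \<sigma> \<in> signs (J \<times> J)"
    using \<sigma> by (fastforce simp: bounded_signs_def signs_def flip_col_def PiE_iff)
  moreover have "bilin J (flip_col J a \<sigma>) x y = bilin J \<sigma> x (\<lambda>i. if i = a then - y i else y i)" for x y
    unfolding bilin_def by (intro sum.cong) (auto simp: flip_col_def)
  moreover have "(\<Sum>i\<in>J. (if i = a then - x i else x i)\<^sup>2) = (\<Sum>i\<in>J. (x i)\<^sup>2)" for x :: "_ \<Rightarrow> real"
    by (intro sum.cong) auto
  ultimately show ?thesis using \<sigma> by (simp add: bounded_signs_def)
qed

lemma bounded_signs_subset: "bounded_signs J \<subseteq> signs (J \<times> J)"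
  by (auto simp: bounded_signs_def)

text \<open>Two different positions differ in their row or in their column. Changing the sign of one such row
or column is an involution of the bounded sign matrices that negates the product of the two
entries.\<close>
lemma bounded_signs_correlation:
  assumes p: "p \<in> J \<times> J" and q: "q \<in> J \<times> J"
  shows "(\<Sum>\<sigma>\<in>bounded_signs J. \<sigma> p * \<sigma> q) = (if p = q then real (card (bounded_signs J)) else 0)"
proof (cases "p = q")
  case True
  have "\<sigma> p * \<sigma> q = 1" if "\<sigma> \<in> bounded_signs J" for \<sigma>
    using signs_square[of \<sigma> "J \<times> J" p] that p True by (auto simp: bounded_signs_def)
  then show ?thesis using True by simp
next
  case False
  have invol: "(\<Sum>\<sigma>\<in>bounded_signs J. \<sigma> p * \<sigma> q) = 0"
    if F: "\<And>\<sigma>. \<sigma> \<in> bounded_signs J \<Longrightarrow> F \<sigma> \<in> bounded_signs J"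
      "\<And>\<sigma>. \<sigma> \<in> bounded_signs J \<Longrightarrow> F (F \<sigma>) = \<sigma>"
      "\<And>\<sigma>. \<sigma> \<in> bounded_signs J \<Longrightarrow> F \<sigma> p * F \<sigma> q = - (\<sigma> p * \<sigma> q)" for F
  proof -
    have "(\<Sum>\<sigma>\<in>bounded_signs J. \<sigma> p * \<sigma> q) = (\<Sum>\<sigma>\<in>bounded_signs J. - (\<sigma> p * \<sigma> q))"
    proof (rule sum.reindex_bij_witness[of _ F F])
      fix \<sigma> assume \<sigma>: "\<sigma> \<in> bounded_signs J"
      show "F (F \<sigma>) = \<sigma>" "F (F \<sigma>) = \<sigma>" "F \<sigma> \<in> bounded_signs J" "F \<sigma> \<in> bounded_signs J"
        using F \<sigma> by auto
      show "- (F \<sigma> p * F \<sigma> q) = \<sigma> p * \<sigma> q" using F(3)[OF \<sigma>] by simp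
    qed
    then show ?thesis by (simp add: sum_negf)
  qed
  have undef: "\<sigma> r = undefined" if "\<sigma> \<in> bounded_signs J" "r \<notin> J \<times> J" for \<sigma> r
    using that by (cases r) (simp add: bounded_signs_def signs_def PiE_iff extensional_def)
  have "(\<Sum>\<sigma>\<in>bounded_signs J. \<sigma> p * \<sigma> q) = 0"
  proof (cases "fst p = fst q")
    case same_row: True
    then have "snd p \<noteq> snd q" using False by (simp add: prod_eq_iff)
    then show ?thesis
      using p q by (intro invol[of "flip_col J (snd p)"] flip_col_bounded_signs)
        (auto simp: flip_col_def fun_eq_iff restrict_def intro: undef[symmetric])
  next
    case False
    then show ?thesis
      using p q by (intro invol[of "flip_row J (fst p)"] flip_row_bounded_signs)
        (auto simp: flip_row_def fun_eq_iff restrict_def intro: undef[symmetric])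
  qed
  then show ?thesis using False by simp
qed

section \<open>The random matrix with small trace\<close>

text \<open>The coefficient of \<open>\<sigma> p\<close> in the multiple of the identity that is added to the block, namely
\<open>\<sigma>\<^sub>n\<^sub>n / \<surd>n\<close> minus the normalized trace of the block; see \<open>sum_diag_shift\<close>. It is used for positions
\<open>p\<close> in \<open>{..n} \<times> {..n}\<close>.\<close>
definition diag_shift :: "nat \<Rightarrow> nat \<times> nat \<Rightarrow> real" where
  "diag_shift n p = (if p = (n, n) then 1 / sqrt n else if fst p = snd p then - 1 / n else 0)"

definition entry_coeff :: "nat \<Rightarrow> nat \<times> nat \<Rightarrow> nat \<times> nat \<Rightarrow> real" where
  "entry_coeff n k p = (if p = k then 1 else 0) + (if fst k = snd k then diag_shift n p else 0)"

text \<open>The entry \<open>\<surd>n \<phi> k\<close> as a linear form in the signs. Orthonormality and the exponential moments are both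
read off from its coefficient vectors.\<close>
definition sign_form :: "nat \<Rightarrow> (nat \<times> nat \<Rightarrow> real) \<Rightarrow> nat \<times> nat \<Rightarrow> real" where
  "sign_form n \<sigma> k = (\<Sum>p\<in>{..n} \<times> {..n}. entry_coeff n k p * \<sigma> p)"

definition sign_mat :: "nat \<Rightarrow> (nat \<times> nat \<Rightarrow> real) \<Rightarrow> complex mat" where
  "sign_mat n \<sigma> = mat n n (\<lambda>k. complex_of_real (sign_form n \<sigma> k / sqrt n))"

lemma sum_diagonal:
  fixes f :: "'i \<times> 'i \<Rightarrow> real"
  assumes "finite J" "\<And>p. fst p \<noteq> snd p \<Longrightarrow> f p = 0"
  shows "(\<Sum>p\<in>J \<times> J. f p) = (\<Sum>i\<in>J. f (i, i))"
proof -
  have "(\<Sum>p\<in>J \<times> J. f p) = (\<Sum>i\<in>J. \<Sum>j\<in>J. f (i, j))" by (simp add: sum.cartesian_product)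
  also have "\<dots> = (\<Sum>i\<in>J. \<Sum>j\<in>J. if j = i then f (i, i) else 0)"
    using assms(2) by (intro sum.cong) auto
  finally show ?thesis using assms(1) by simp
qed

lemma sum_diag_shift:
  "(\<Sum>p\<in>{..n} \<times> {..n}. diag_shift n p * \<sigma> p) = \<sigma> (n, n) / sqrt n - (\<Sum>i<n. \<sigma> (i, i)) / n"
proof -
  have "(\<Sum>p\<in>{..n} \<times> {..n}. diag_shift n p * \<sigma> p) = (\<Sum>i\<le>n. diag_shift n (i, i) * \<sigma> (i, i))"
    by (rule sum_diagonal) (auto simp: diag_shift_def)
  also have "\<dots> = \<sigma> (n, n) / sqrt n + (\<Sum>i<n. (- 1 / n) * \<sigma> (i, i))"
    by (simp add: diag_shift_def lessThan_Suc_atMost[symmetric])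
  also have "(\<Sum>i<n. (- 1 / n) * \<sigma> (i, i)) = - ((\<Sum>i<n. \<sigma> (i, i)) / n)"
    by (simp add: sum_divide_distrib sum_negf)
  finally show ?thesis by simp
qed

lemma sign_form_eq:
  assumes "k \<in> {..n} \<times> {..n}"
  shows "sign_form n \<sigma> k = \<sigma> k + (if fst k = snd k then \<sigma> (n, n) / sqrt n - (\<Sum>i<n. \<sigma> (i, i)) / n else 0)"
proof -
  have "sign_form n \<sigma> k = (\<Sum>p\<in>{..n} \<times> {..n}. (if p = k then \<sigma> k else 0) +
      (if fst k = snd k then diag_shift n p * \<sigma> p else 0))"
    unfolding sign_form_def entry_coeff_def by (intro sum.cong) (auto simp: algebra_simps)
  also have "\<dots> = \<sigma> k + (if fst k = snd k then (\<Sum>p\<in>{..n} \<times> {..n}. diag_shift n p * \<sigma> p) else 0)"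
    using assms by (simp add: sum.distrib)
  finally show ?thesis by (simp add: sum_diag_shift)
qed

text \<open>Off the diagonal the coefficient vectors are standard unit vectors. On the diagonal they are
\<open>e\<^sub>k + D\<close> with \<open>D = diag_shift n\<close>, where \<open>\<langle>e\<^sub>k, D\<rangle> = -1/n\<close> and \<open>|D|\<^sup>2 = 1/n + n (1/n\<^sup>2) = 2/n\<close>; the
corrections \<open>-1/n - 1/n + 2/n\<close> cancel.\<close>
lemma entry_coeff_orthonormal:
  assumes n: "n \<ge> 1" and k: "k \<in> {..<n} \<times> {..<n}" and l: "l \<in> {..<n} \<times> {..<n}"
  shows "(\<Sum>p\<in>{..n} \<times> {..n}. entry_coeff n k p * entry_coeff n l p) = (if k = l then 1 else 0)"
proof -
  define e where "e k = (if fst k = snd k then 1 else 0 :: real)" for k :: "nat \<times> nat"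
  have mem: "k \<in> {..n} \<times> {..n}" "l \<in> {..n} \<times> {..n}" using k l by auto
  have ds: "diag_shift n k = - e k / n" "diag_shift n l = - e l / n"
    using k l by (auto simp: diag_shift_def e_def)
  have "(\<Sum>p\<in>{..n} \<times> {..n}. diag_shift n p * diag_shift n p) = 2 / n"
    using n by (subst sum_diag_shift) (simp add: diag_shift_def field_simps)
  moreover have "entry_coeff n k p * entry_coeff n l p =
      (if p = k then (if k = l then 1 else 0) + e l * diag_shift n k else 0) +
      (if p = l then e k * diag_shift n l else 0) + e k * e l * (diag_shift n p * diag_shift n p)" for p
    by (auto simp: entry_coeff_def e_def algebra_simps)
  ultimately have "(\<Sum>p\<in>{..n} \<times> {..n}. entry_coeff n k p * entry_coeff n l p) =
      (if k = l then 1 else 0) + e l * diag_shift n k + e k * diag_shift n l + e k * e l * (2 / n)"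
    using mem by (simp add: sum.distrib sum_distrib_left[symmetric])
  then show ?thesis by (simp add: ds)
qed

lemma sign_form_orthonormal:
  assumes n: "n \<ge> 1" and k: "k \<in> {..<n} \<times> {..<n}" and l: "l \<in> {..<n} \<times> {..<n}"
  shows "(\<Sum>\<sigma>\<in>bounded_signs {..n}. sign_form n \<sigma> k * sign_form n \<sigma> l) =
    (if k = l then real (card (bounded_signs {..n})) else 0)"
proof -
  let ?G = "bounded_signs {..n}" and ?I = "{..n} \<times> {..n}"
  have "(\<Sum>\<sigma>\<in>?G. sign_form n \<sigma> k * sign_form n \<sigma> l) =
      (\<Sum>\<sigma>\<in>?G. \<Sum>p\<in>?I. \<Sum>q\<in>?I. entry_coeff n k p * entry_coeff n l q * (\<sigma> p * \<sigma> q))"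
    unfolding sign_form_def by (simp only: sum_product mult_ac)
  also have "\<dots> = (\<Sum>p\<in>?I. \<Sum>\<sigma>\<in>?G. \<Sum>q\<in>?I. entry_coeff n k p * entry_coeff n l q * (\<sigma> p * \<sigma> q))"
    by (rule sum.swap)
  also have "\<dots> = (\<Sum>p\<in>?I. \<Sum>q\<in>?I. \<Sum>\<sigma>\<in>?G. entry_coeff n k p * entry_coeff n l q * (\<sigma> p * \<sigma> q))"
    by (intro sum.cong refl sum.swap)
  also have "\<dots> = (\<Sum>p\<in>?I. \<Sum>q\<in>?I. entry_coeff n k p * entry_coeff n l q * (if p = q then real (card ?G) else 0))"
    by (intro sum.cong refl) (simp only: sum_distrib_left[symmetric] bounded_signs_correlation)
  also have "\<dots> = (\<Sum>p\<in>?I. \<Sum>q\<in>?I. if q = p then entry_coeff n k p * entry_coeff n l p * real (card ?G) else 0)"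
    by (intro sum.cong refl) auto
  also have "\<dots> = (\<Sum>p\<in>?I. entry_coeff n k p * entry_coeff n l p * real (card ?G))"
    by (intro sum.cong refl) simp
  also have "\<dots> = (\<Sum>p\<in>?I. entry_coeff n k p * entry_coeff n l p) * real (card ?G)"
    by (simp only: sum_distrib_right)
  finally show ?thesis by (simp add: entry_coeff_orthonormal[OF n k l])
qed

text \<open>By orthonormality of the coefficient vectors, the combination with coefficients \<open>x\<close> is a sign sum
whose coefficients have the same Euclidean norm as \<open>x\<close>. Conditioning on a set of proportion at least \<open>2/3\<close>
costs a factor of at most \<open>3/2 \<le> exp (1/2)\<close>, which together with the bound \<open>exp (1/2)\<close> for all signs gives exactly \<open>e\<close>.\<close>
lemma sign_form_mgf:
  fixes x :: "nat \<times> nat \<Rightarrow> complex"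
  assumes n: "n \<ge> 1" and x: "(\<Sum>k\<in>{..<n} \<times> {..<n}. (cmod (x k))\<^sup>2) \<le> 1"
  shows "(\<Sum>\<sigma>\<in>bounded_signs {..n}. exp ((cmod (\<Sum>k\<in>{..<n} \<times> {..<n}. x k * of_real (sign_form n \<sigma> k)))\<^sup>2 / 8))
    \<le> real (card (bounded_signs {..n})) * exp 1"
proof -
  let ?G = "bounded_signs {..n}" and ?I = "{..n} \<times> {..n}" and ?K = "{..<n} \<times> {..<n}"
  define c where "c p = (\<Sum>k\<in>?K. x k * of_real (entry_coeff n k p))" for p
  have form: "(\<Sum>k\<in>?K. x k * of_real (sign_form n \<sigma> k)) = (\<Sum>p\<in>?I. c p * of_real (\<sigma> p))" for \<sigma>
  proof -
    have "(\<Sum>k\<in>?K. x k * of_real (sign_form n \<sigma> k)) =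
        (\<Sum>k\<in>?K. \<Sum>p\<in>?I. x k * of_real (entry_coeff n k p) * of_real (\<sigma> p))"
      by (simp only: sign_form_def of_real_sum of_real_mult sum_distrib_left mult.assoc)
    also have "\<dots> = (\<Sum>p\<in>?I. \<Sum>k\<in>?K. x k * of_real (entry_coeff n k p) * of_real (\<sigma> p))"
      by (rule sum.swap)
    finally show ?thesis by (simp only: c_def sum_distrib_right)
  qed
  have "complex_of_real (\<Sum>p\<in>?I. (cmod (c p))\<^sup>2) = (\<Sum>p\<in>?I. c p * cnj (c p))"
    by (simp only: of_real_sum complex_norm_square)
  also have "\<dots> = (\<Sum>p\<in>?I. \<Sum>k\<in>?K. \<Sum>l\<in>?K. x k * cnj (x l) * of_real (entry_coeff n k p * entry_coeff n l p))"
    by (simp only: c_def cnj_sum complex_cnj_mult complex_cnj_complex_of_real sum_product of_real_mult mult_ac)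
  also have "\<dots> = (\<Sum>k\<in>?K. \<Sum>p\<in>?I. \<Sum>l\<in>?K. x k * cnj (x l) * of_real (entry_coeff n k p * entry_coeff n l p))"
    by (rule sum.swap)
  also have "\<dots> = (\<Sum>k\<in>?K. \<Sum>l\<in>?K. \<Sum>p\<in>?I. x k * cnj (x l) * of_real (entry_coeff n k p * entry_coeff n l p))"
    by (intro sum.cong refl sum.swap)
  also have "\<dots> = (\<Sum>k\<in>?K. \<Sum>l\<in>?K. x k * cnj (x l) * of_real (if k = l then 1 else 0))"
    by (intro sum.cong refl) (simp only: sum_distrib_left[symmetric] of_real_sum[symmetric] entry_coeff_orthonormal[OF n])
  also have "\<dots> = (\<Sum>k\<in>?K. \<Sum>l\<in>?K. if l = k then x k * cnj (x k) else 0)"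
    by (intro sum.cong refl) auto
  also have "\<dots> = (\<Sum>k\<in>?K. x k * cnj (x k))"
    by (intro sum.cong refl) simp
  also have "\<dots> = complex_of_real (\<Sum>k\<in>?K. (cmod (x k))\<^sup>2)"
    by (simp only: of_real_sum complex_norm_square)
  finally have c: "(\<Sum>p\<in>?I. (cmod (c p))\<^sup>2) \<le> 1" using x by (simp only: of_real_eq_iff)
  have "(\<Sum>\<sigma>\<in>?G. exp ((cmod (\<Sum>k\<in>?K. x k * of_real (sign_form n \<sigma> k)))\<^sup>2 / 8)) \<le>
      (\<Sum>\<sigma>\<in>signs ?I. exp ((cmod (\<Sum>p\<in>?I. c p * of_real (\<sigma> p)))\<^sup>2 / 8))"
    unfolding form by (intro sum_mono2 bounded_signs_subset) auto
  also have "\<dots> \<le> 2 ^ card ?I * exp (1 / 2)"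
    by (intro rademacher_square_mgf_complex c) auto
  also have "\<dots> \<le> (real (card ?G) * (3 / 2)) * exp (1 / 2)"
    using card_bounded_signs[of "{..n}"] by (intro mult_right_mono) auto
  also have "\<dots> \<le> (real (card ?G) * exp (1 / 2)) * exp (1 / 2)"
    using exp_ge_add_one_self[of "1 / 2"] by (intro mult_right_mono mult_left_mono) auto
  also have "\<dots> = real (card ?G) * exp 1"
    by (simp only: mult.assoc mult_exp_exp) simp
  finally show ?thesis .
qed

section \<open>The extremal example and the theorem\<close>

text \<open>An injection of \<open>G\<close> into the reals carries the uniform distribution to the real line, the sample space
of the example.\<close>
lemma exists_real_uniform:
  fixes G :: "'b set"
  assumes G: "finite G" "G \<noteq> {}"
  shows "\<exists>(p :: real pmf) g. map_pmf g p = pmf_of_set G"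
proof -
  obtain f :: "'b \<Rightarrow> nat" where f: "inj_on f G"
    using finite_imp_inj_to_nat_seg[OF G(1)] by blast
  define r where "r x = real (f x)" for x
  have r: "inj_on r G" using f by (auto simp: inj_on_def r_def)
  have "map_pmf (inv_into G r) (map_pmf r (pmf_of_set G)) = map_pmf id (pmf_of_set G)"
    unfolding map_pmf_comp using G r by (intro map_pmf_cong) (auto simp: inv_into_f_f)
  also have "\<dots> = pmf_of_set G" by (simp only: map_pmf_id id_apply)
  finally show ?thesis by blast
qed

lemma diagonal_shift_bound:
  fixes n :: nat
  assumes n: "n \<ge> 1" and \<sigma>: "\<sigma> \<in> signs ({..n} \<times> {..n})"
  shows "\<bar>\<sigma> (n, n) / sqrt n - (\<Sum>i<n. \<sigma> (i, i)) / n\<bar> \<le> 2"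
proof -
  have abs1: "\<bar>\<sigma> (i, i)\<bar> = 1" if "i \<le> n" for i using signsD[OF \<sigma>, of "(i, i)"] that by auto
  have "\<bar>\<Sum>i<n. \<sigma> (i, i)\<bar> \<le> (\<Sum>i<n. \<bar>\<sigma> (i, i)\<bar>)" by (rule sum_abs)
  also have "\<dots> = n" by (simp add: abs1)
  finally have "\<bar>(\<Sum>i<n. \<sigma> (i, i)) / n\<bar> \<le> 1" using n by (simp add: abs_divide)
  moreover have "\<bar>\<sigma> (n, n) / sqrt n\<bar> \<le> 1" using n by (simp add: abs_divide abs1)
  ultimately show ?thesis by linarith
qed

text \<open>The shift of the diagonal is at most \<open>2\<close>, so with \<open>(u + v)\<^sup>2 \<le> 2u\<^sup>2 + 2v\<^sup>2\<close> and \<open>n + 1 \<le> 2n\<close> the squared norm is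
at most \<open>2 * 784 (n + 1) / n + 2 * 4 / n \<le> 3144 \<le> 60\<^sup>2\<close>. As the entries are real, the real and the
imaginary part of a vector can be treated separately.\<close>
lemma sign_mat_op_norm:
  assumes n: "n \<ge> 1" and \<sigma>: "\<sigma> \<in> bounded_signs {..n}"
  shows "mat_op_norm (sign_mat n \<sigma>) \<le> 60"
proof -
  define d where "d = \<sigma> (n, n) / sqrt n - (\<Sum>i<n. \<sigma> (i, i)) / n"
  have d: "d\<^sup>2 \<le> 4"
    using diagonal_shift_bound[OF n] \<sigma> bounded_signs_subset[of "{..n}"] power_mono[of "\<bar>d\<bar>" 2 2]
    by (auto simp: d_def)
  have A: "sign_mat n \<sigma> \<in> carrier_mat n n" by (simp add: sign_mat_def)
  have entry: "sign_mat n \<sigma> $$ (i, j) = complex_of_real ((\<sigma> (i, j) + (if i = j then d else 0)) / sqrt n)"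
    if "i < n" "j < n" for i j
    using that by (simp add: sign_mat_def sign_form_eq d_def)
  have real_bound: "(\<Sum>i<n. (\<Sum>j<n. (\<sigma> (i, j) + (if i = j then d else 0)) * y j)\<^sup>2) \<le> 3600 * n * (\<Sum>j<n. (y j)\<^sup>2)"
    for y :: "nat \<Rightarrow> real"
  proof -
    define Y where "Y = (\<Sum>j<n. (y j)\<^sup>2)"
    have Y: "0 \<le> Y" by (simp add: Y_def sum_nonneg)
    \<comment> \<open>The block inherits the bound of the full matrix by extending vectors by zero.\<close>
    define z where "z j = (if j < n then y j else 0)" for j
    have z_sum: "(\<Sum>j\<le>n. f j * z j) = (\<Sum>j<n. f j * y j)" for f
      by (simp add: z_def lessThan_Suc_atMost[symmetric])
    have "(\<Sum>i<n. (\<Sum>j<n. (\<sigma> (i, j) + (if i = j then d else 0)) * y j)\<^sup>2) =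
        (\<Sum>i<n. ((\<Sum>j<n. \<sigma> (i, j) * y j) + d * y i)\<^sup>2)"
    proof (intro sum.cong refl)
      fix i assume "i \<in> {..<n}"
      then have "(\<Sum>j<n. (if i = j then d else 0) * y j) = d * y i"
        by (simp add: if_distrib[of "\<lambda>x. x * _"] cong: if_cong)
      then show "(\<Sum>j<n. (\<sigma> (i, j) + (if i = j then d else 0)) * y j)\<^sup>2 = ((\<Sum>j<n. \<sigma> (i, j) * y j) + d * y i)\<^sup>2"
        by (simp add: distrib_right sum.distrib)
    qed
    also have "\<dots> \<le> (\<Sum>i<n. 2 * (\<Sum>j<n. \<sigma> (i, j) * y j)\<^sup>2 + 2 * d\<^sup>2 * (y i)\<^sup>2)"
    proof (rule sum_mono)
      fix i
      have "(u + v)\<^sup>2 \<le> 2 * u\<^sup>2 + 2 * v\<^sup>2" for u v :: real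
        using zero_le_power2[of "u - v"] by (simp add: power2_eq_square algebra_simps)
      then show "((\<Sum>j<n. \<sigma> (i, j) * y j) + d * y i)\<^sup>2 \<le> 2 * (\<Sum>j<n. \<sigma> (i, j) * y j)\<^sup>2 + 2 * d\<^sup>2 * (y i)\<^sup>2"
        by (simp only: mult.assoc power_mult_distrib[symmetric])
    qed
    also have "\<dots> = 2 * (\<Sum>i<n. (\<Sum>j<n. \<sigma> (i, j) * y j)\<^sup>2) + 2 * d\<^sup>2 * Y"
      by (simp add: sum.distrib sum_distrib_left Y_def)
    also have "(\<Sum>i<n. (\<Sum>j<n. \<sigma> (i, j) * y j)\<^sup>2) \<le> (\<Sum>i\<le>n. (\<Sum>j\<le>n. \<sigma> (i, j) * z j)\<^sup>2)"
      unfolding z_sum by (intro sum_mono2) auto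
    also have "\<dots> \<le> 784 * card {..n} * (\<Sum>j\<le>n. (z j)\<^sup>2)"
      by (rule bounded_signs_apply[OF _ \<sigma>]) simp
    also have "(\<Sum>j\<le>n. (z j)\<^sup>2) = Y"
      by (simp add: z_def Y_def lessThan_Suc_atMost[symmetric])
    also have "784 * card {..n} * Y \<le> 1568 * n * Y"
      using n Y by (intro mult_right_mono) auto
    also have "2 * d\<^sup>2 * Y \<le> 8 * n * Y"
    proof (intro mult_right_mono Y)
      show "2 * d\<^sup>2 \<le> real (8 * n)" using d n by simp
    qed
    finally have "(\<Sum>i<n. (\<Sum>j<n. (\<sigma> (i, j) + (if i = j then d else 0)) * y j)\<^sup>2) \<le> 3144 * (n * Y)"
      by (simp add: algebra_simps)
    also have "\<dots> \<le> 3600 * (n * Y)" using Y by (intro mult_right_mono) auto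
    finally show ?thesis by (simp add: Y_def mult.assoc)
  qed
  have "hilbert_norm (sign_mat n \<sigma> *\<^sub>v v) \<le> 60" if v: "v \<in> carrier_vec n" "hilbert_norm v \<le> 1" for v
  proof -
    define w where "w i j = (\<sigma> (i, j) + (if i = j then d else 0)) / sqrt n" for i j
    have "(\<Sum>i<n. (cmod (v $ i))\<^sup>2) \<le> 1"
      using v by (simp add: hilbert_norm_def cscalar_prod_self)
    then have V: "(\<Sum>j<n. (Re (v $ j))\<^sup>2) + (\<Sum>j<n. (Im (v $ j))\<^sup>2) \<le> 1"
      by (simp add: cmod_power2 sum.distrib)
    have scaled: "(\<Sum>i<n. (\<Sum>j<n. w i j * y j)\<^sup>2) \<le> 3600 * (\<Sum>j<n. (y j)\<^sup>2)" for y
    proof -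
      have "(\<Sum>i<n. (\<Sum>j<n. w i j * y j)\<^sup>2) = (\<Sum>i<n. (\<Sum>j<n. (\<sigma> (i, j) + (if i = j then d else 0)) * y j)\<^sup>2) / n"
        by (simp add: w_def sum_divide_distrib[symmetric] power_divide)
      also have "\<dots> \<le> (3600 * n * (\<Sum>j<n. (y j)\<^sup>2)) / n"
        by (intro divide_right_mono real_bound) simp
      finally show ?thesis using n by simp
    qed
    have Av: "(sign_mat n \<sigma> *\<^sub>v v) $ i = (\<Sum>j<n. complex_of_real (w i j) * v $ j)" if "i < n" for i
      unfolding mult_vec_index[OF A v(1) that] using that by (intro sum.cong) (simp_all add: entry w_def)
    have "(\<Sum>i<n. (cmod ((sign_mat n \<sigma> *\<^sub>v v) $ i))\<^sup>2) =
        (\<Sum>i<n. (\<Sum>j<n. w i j * Re (v $ j))\<^sup>2) + (\<Sum>i<n. (\<Sum>j<n. w i j * Im (v $ j))\<^sup>2)"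
      by (simp add: Av cmod_power2 sum.distrib del: index_mult_mat_vec)
    also have "\<dots> \<le> 3600 * (\<Sum>j<n. (Re (v $ j))\<^sup>2) + 3600 * (\<Sum>j<n. (Im (v $ j))\<^sup>2)"
      by (intro add_mono scaled)
    also have "\<dots> \<le> 60\<^sup>2" using V by simp
    finally show ?thesis
      using A v(1) by (simp add: hilbert_norm_def cscalar_prod_self[of _ n] real_le_lsqrt del: index_mult_mat_vec)
  qed
  note bound = this
  have zero: "0\<^sub>v n \<in> {v \<in> carrier_vec n. hilbert_norm v \<le> 1}"
    by (simp add: hilbert_norm_def)
  have cols: "dim_col (sign_mat n \<sigma>) = n" by (simp add: sign_mat_def)
  show ?thesis
    unfolding mat_op_norm_def cols
  proof (rule cSUP_least)
    show "{v \<in> carrier_vec n. hilbert_norm v \<le> 1} \<noteq> {}" using zero by blast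
  qed (simp add: bound)
qed

lemma mat_abs_one: "mat_abs (1\<^sub>m n) = 1\<^sub>m n"
proof -
  have "mat_adjoint (1\<^sub>m n) = (1\<^sub>m n :: complex mat)"
    by (intro eq_matI) (auto simp: mat_adjoint_index[of _ n n])
  then show ?thesis
    using adjoint_mult_psd[of "1\<^sub>m n" n n] by (simp add: mat_abs_def mat_sqrt_eqI[of n])
qed

text \<open>The shift removes the trace of the block and adds \<open>n\<close> copies of \<open>\<sigma>\<^sub>n\<^sub>n / \<surd>n\<close>; the scaling of the matrix by
\<open>1 / \<surd>n\<close> leaves \<open>\<sigma>\<^sub>n\<^sub>n\<close>.\<close>
lemma sign_mat_trace:
  assumes n: "n \<ge> 1"
  shows "mat_trace (1\<^sub>m n * sign_mat n \<sigma>) = complex_of_real (\<sigma> (n, n))"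
proof -
  define d where "d = \<sigma> (n, n) / sqrt n - (\<Sum>i<n. \<sigma> (i, i)) / n"
  have A: "sign_mat n \<sigma> \<in> carrier_mat n n" by (simp add: sign_mat_def)
  have "mat_trace (1\<^sub>m n * sign_mat n \<sigma>) = (\<Sum>i<n. sign_mat n \<sigma> $$ (i, i))"
    using A by (simp add: mat_trace_def)
  also have "\<dots> = (\<Sum>i<n. complex_of_real ((\<sigma> (i, i) + d) / sqrt n))"
    by (intro sum.cong) (simp_all add: sign_mat_def sign_form_eq d_def)
  also have "\<dots> = complex_of_real ((\<Sum>i<n. \<sigma> (i, i) + d) / sqrt n)"
    by (simp only: of_real_sum sum_divide_distrib)
  also have "(\<Sum>i<n. \<sigma> (i, i) + d) = n * (\<sigma> (n, n) / sqrt n)"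
    using n by (simp add: sum.distrib right_diff_distrib d_def)
  also have "n * (\<sigma> (n, n) / sqrt n) / sqrt n = \<sigma> (n, n)" using n by simp
  finally show ?thesis .
qed

lemma optimal_order_example:
  assumes n: "n \<ge> 1"
  shows "\<exists>(M :: real measure) (\<phi> :: real \<Rightarrow> complex mat) (a :: complex mat).
    prob_space M \<and> mat_measurable n M \<phi> \<and>
    (AE t in M. mat_op_norm (\<phi> t) \<le> 60) \<and>
    subgaussian M (sqrt 8) ({..<n} \<times> {..<n}) (scaled_entries n \<phi>) \<and>
    orthonormal_L2 M ({..<n} \<times> {..<n}) (scaled_entries n \<phi>) \<and>
    a \<in> carrier_mat n n \<and> a \<noteq> 0\<^sub>m n n \<and>
    ereal (Re (mat_trace (mat_abs a))) \<ge> ereal (1 * real n) * Linf_norm M (\<lambda>t. mat_trace (a * \<phi> t))"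
proof -
  let ?I = "{..<n} \<times> {..<n}"
  define G where "G = bounded_signs {..n}"
  have "0 < (2 / 3 :: real) * 2 ^ card ({..n} \<times> {..n})" by simp
  also have "\<dots> \<le> real (card G)" unfolding G_def by (rule card_bounded_signs) auto
  finally have cardG: "0 < card G" by simp
  then have G: "finite G" "G \<noteq> {}" by (auto simp: card_gt_0_iff)
  obtain p :: "real pmf" and g where pg: "map_pmf g p = pmf_of_set G"
    using exists_real_uniform[OF G] by blast
  define \<phi> where "\<phi> t = sign_mat n (g t)" for t
  have gG: "g t \<in> G" if "t \<in> set_pmf p" for t
    using that arg_cong[OF pg, of set_pmf] G by auto
  have se: "scaled_entries n \<phi> k t = complex_of_real (sign_form n (g t) k)" if "k \<in> ?I" for k t
  proof -
    have "scaled_entries n \<phi> k t = complex_of_real (sqrt n) * complex_of_real (sign_form n (g t) k / sqrt n)"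
      using that by (auto simp: scaled_entries_def \<phi>_def sign_mat_def)
    also have "\<dots> = complex_of_real (sqrt n * (sign_form n (g t) k / sqrt n))"
      by (rule of_real_mult[symmetric])
    also have "sqrt n * (sign_form n (g t) k / sqrt n) = sign_form n (g t) k" using n by simp
    finally show ?thesis .
  qed
  have mean: "(LINT t|measure_pmf p. f (g t)) = (\<Sum>\<sigma>\<in>G. f \<sigma>) / card G" for f :: "_ \<Rightarrow> real"
    using integral_map_pmf[of g p f] integral_pmf_of_set[OF G(2,1), of f] by (simp add: pg)
  have "subgaussian (measure_pmf p) (sqrt 8) ?I (scaled_entries n \<phi>)"
    unfolding subgaussian_def
  proof (intro conjI ballI allI impI)
    fix x :: "nat \<times> nat \<Rightarrow> complex" assume x: "(\<Sum>k\<in>?I. (cmod (x k))\<^sup>2) \<le> 1"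
    define E where "E \<sigma> = exp ((cmod (\<Sum>k\<in>?I. x k * of_real (sign_form n \<sigma> k)))\<^sup>2 / 8)" for \<sigma>
    have "(\<integral>\<^sup>+ t. ennreal (exp ((cmod (\<Sum>k\<in>?I. x k * scaled_entries n \<phi> k t))\<^sup>2 / (sqrt 8)\<^sup>2)) \<partial>measure_pmf p) =
        (\<integral>\<^sup>+ t. ennreal (E (g t)) \<partial>measure_pmf p)"
      by (simp add: E_def se)
    also have "\<dots> = (\<integral>\<^sup>+ \<sigma>. ennreal (E \<sigma>) \<partial>measure_pmf (pmf_of_set G))"
      by (simp flip: pg)
    also have "\<dots> = (\<Sum>\<sigma>\<in>G. ennreal (E \<sigma>)) / of_nat (card G)"
      by (rule nn_integral_pmf_of_set[OF G(2,1)])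
    also have "\<dots> = ennreal ((\<Sum>\<sigma>\<in>G. E \<sigma>) / card G)"
      using cardG by (simp add: E_def sum_nonneg divide_ennreal[symmetric] ennreal_of_nat_eq_real_of_nat)
    also have "\<dots> \<le> ennreal (exp 1)"
      using sign_form_mgf[OF n x] cardG
      by (intro ennreal_leI) (simp add: E_def G_def pos_divide_le_eq mult.commute)
    finally show "(\<integral>\<^sup>+ t. ennreal (exp ((cmod (\<Sum>k\<in>?I. x k * scaled_entries n \<phi> k t))\<^sup>2 / (sqrt 8)\<^sup>2)) \<partial>measure_pmf p)
        \<le> ennreal (exp 1)" .
  qed auto
  moreover have "orthonormal_L2 (measure_pmf p) ?I (scaled_entries n \<phi>)"
    unfolding orthonormal_L2_def
  proof (intro conjI ballI)
    fix k l assume k: "k \<in> ?I" and l: "l \<in> ?I"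
    have "(LINT t|measure_pmf p. scaled_entries n \<phi> k t * cnj (scaled_entries n \<phi> l t)) =
        (LINT t|measure_pmf p. complex_of_real (sign_form n (g t) k * sign_form n (g t) l))"
      by (simp add: se[OF k] se[OF l])
    also have "\<dots> = complex_of_real (LINT t|measure_pmf p. sign_form n (g t) k * sign_form n (g t) l)"
      by (rule integral_complex_of_real)
    also have "(LINT t|measure_pmf p. sign_form n (g t) k * sign_form n (g t) l) =
        (\<Sum>\<sigma>\<in>G. sign_form n \<sigma> k * sign_form n \<sigma> l) / card G"
      by (rule mean)
    also have "\<dots> = (if k = l then 1 else 0)"
      using cardG unfolding G_def sign_form_orthonormal[OF n k l] by simp
    finally show "(LINT t|measure_pmf p. scaled_entries n \<phi> k t * cnj (scaled_entries n \<phi> l t)) = (if k = l then 1 else 0)"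
      by simp
  next
    fix k assume k: "k \<in> ?I"
    have "integrable (measure_pmf (map_pmf g p)) (\<lambda>\<sigma>. (cmod (complex_of_real (sign_form n \<sigma> k)))\<^sup>2)"
      unfolding pg using G by (intro integrable_measure_pmf_finite) simp
    then show "integrable (measure_pmf p) (\<lambda>t. (cmod (scaled_entries n \<phi> k t))\<^sup>2)"
      by (simp only: integrable_map_pmf_eq se[OF k])
  qed auto
  moreover have "AE t in measure_pmf p. mat_op_norm (\<phi> t) \<le> 60"
    using gG sign_mat_op_norm[OF n] by (auto simp: AE_measure_pmf_iff \<phi>_def G_def)
  moreover have "mat_measurable n (measure_pmf p) \<phi>"
    by (auto simp: mat_measurable_def \<phi>_def sign_mat_def)
  moreover have "(1\<^sub>m n :: complex mat) \<noteq> 0\<^sub>m n n"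
  proof
    assume "(1\<^sub>m n :: complex mat) = 0\<^sub>m n n"
    then have "(1\<^sub>m n :: complex mat) $$ (0, 0) = 0\<^sub>m n n $$ (0, 0)" by (simp only:)
    then show False using n by simp
  qed
  moreover have "ereal (1 * real n) * Linf_norm (measure_pmf p) (\<lambda>t. mat_trace (1\<^sub>m n * \<phi> t))
      \<le> ereal (Re (mat_trace (mat_abs (1\<^sub>m n))))"
  proof -
    have "cmod (mat_trace (1\<^sub>m n * \<phi> t)) = 1" if "t \<in> set_pmf p" for t
    proof -
      have "g t \<in> signs ({..n} \<times> {..n})" using gG[OF that] bounded_signs_subset by (auto simp: G_def)
      then have "g t (n, n) = -1 \<or> g t (n, n) = 1" by (rule signsD) simp
      then show ?thesis unfolding \<phi>_def sign_mat_trace[OF n] by auto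
    qed
    then have "Linf_norm (measure_pmf p) (\<lambda>t. mat_trace (1\<^sub>m n * \<phi> t)) \<le> ereal 1"
      unfolding Linf_norm_def by (intro esssup_I) (auto simp: AE_measure_pmf_iff)
    then have "ereal (1 * real n) * Linf_norm (measure_pmf p) (\<lambda>t. mat_trace (1\<^sub>m n * \<phi> t)) \<le> ereal (1 * real n) * ereal 1"
      by (intro ereal_mult_left_mono) auto
    also have "\<dots> = ereal (Re (mat_trace (mat_abs (1\<^sub>m n))))"
      unfolding mat_abs_one by (simp add: mat_trace_def)
    finally show ?thesis .
  qed
  ultimately show ?thesis
    using prob_space_measure_pmf[of p] one_carrier_mat[of n] by blast
qed

theorem mainTheorem3:
  shows "(\<forall>n::nat. \<forall>M :: 'a measure. \<forall>\<phi> :: 'a \<Rightarrow> complex mat.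
            n \<ge> 1 \<and> prob_space M \<and> mat_measurable n M \<phi> \<and> mat_ess_bounded M \<phi> \<and>
            orthonormal_L2 M ({..<n} \<times> {..<n}) (scaled_entries n \<phi>) \<longrightarrow>
            (\<forall>a \<in> carrier_mat n n.
               ereal (Re (mat_trace (mat_abs a)))
                 \<le> ereal (real n) * Linf_norm M (\<lambda>t. mat_trace (a * \<phi> t))))
       \<and> (\<exists>C \<beta> \<delta> :: real. C > 0 \<and> \<beta> > 0 \<and> \<delta> > 0 \<and>
            (\<forall>n::nat. n \<ge> 1 \<longrightarrow>
               (\<exists>(M :: real measure) (\<phi> :: real \<Rightarrow> complex mat) (a :: complex mat).
                  prob_space M \<and> mat_measurable n M \<phi> \<and>
                  (AE t in M. mat_op_norm (\<phi> t) \<le> C) \<and>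
                  subgaussian M \<beta> ({..<n} \<times> {..<n}) (scaled_entries n \<phi>) \<and>
                  orthonormal_L2 M ({..<n} \<times> {..<n}) (scaled_entries n \<phi>) \<and>
                  a \<in> carrier_mat n n \<and> a \<noteq> 0\<^sub>m n n \<and>
                  ereal (Re (mat_trace (mat_abs a)))
                    \<ge> ereal (\<delta> * real n) * Linf_norm M (\<lambda>t. mat_trace (a * \<phi> t)))))"
proof (intro conjI)
  show "\<exists>C \<beta> \<delta> :: real. C > 0 \<and> \<beta> > 0 \<and> \<delta> > 0 \<and>
            (\<forall>n::nat. n \<ge> 1 \<longrightarrow>
               (\<exists>(M :: real measure) (\<phi> :: real \<Rightarrow> complex mat) (a :: complex mat).
                  prob_space M \<and> mat_measurable n M \<phi> \<and>
                  (AE t in M. mat_op_norm (\<phi> t) \<le> C) \<and>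
                  subgaussian M \<beta> ({..<n} \<times> {..<n}) (scaled_entries n \<phi>) \<and>
                  orthonormal_L2 M ({..<n} \<times> {..<n}) (scaled_entries n \<phi>) \<and>
                  a \<in> carrier_mat n n \<and> a \<noteq> 0\<^sub>m n n \<and>
                  ereal (Re (mat_trace (mat_abs a)))
                    \<ge> ereal (\<delta> * real n) * Linf_norm M (\<lambda>t. mat_trace (a * \<phi> t))))"
    by (rule exI[of _ 60], rule exI[of _ "sqrt 8"], rule exI[of _ 1]) (use optimal_order_example in simp)
qed (use trace_abs_le_Linf in blast)

end
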